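(* Let $\psi\in C^0(\mathbb{R}^N\times[0,\infty))$ satisfy $\psi\ge0$, $\psi(x,t)\to+\infty$ as $|x|\to\infty$ uniformly for $t\in[0,\infty)$, and $\psi_t\ge J\ast\psi-\psi$. Then there exists at most one strong solution $u$ of $u_t=J\ast u-u$ in $\mathbb{R}^N\times(0,\infty)$ with $u(x,0)=u_0(x)$ such that $|u|\ll\psi$ locally uniformly in $[0,\infty)$.
   Context: $J:\mathbb{R}^N\to\mathbb{R}$ is a nonnegative symmetric continuous function with $\int_{\mathbb{R}^N}J=1$; $\ast$ is convolution in the space variable; the initial datum $u_0:\mathbb{R}^N\to\mathbb{R}$ is locally bounded. Strong solution: $u\in C^0([0,\infty);L^1_{\rm loc}(\mathbb{R}^N))$ such that $u_t,J\ast u\in L^1_{\rm loc}(\mathbb{R}^N\times\mathbb{R}_+)$, with $\mathbb{R}_+=(0,\infty)$, the equation is satisfied in the $L^1_{\rm loc}$-sense, and $u(x,0)=u_0(x)$ almost everywhere. For $u,v:\mathbb{R}^N\times[0,\infty)\to\mathbb{R}$, "$u\ll v$ locally uniformly in $[0,\infty)$" means $|u(x,t)|\le C(t)\epsilon(x)|v(x,t)|$ for some $C\in L^\infty_{\rm loc}([0,\infty))$ and some $\epsilon(x)\to0$ as $|x|\to\infty$. *)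

theory Defs
  imports "HOL-Analysis.Analysis"
begin

definition L1loc :: "'b::euclidean_space set \<Rightarrow> ('b \<Rightarrow> real) \<Rightarrow> bool" where
  "L1loc S f \<longleftrightarrow> (\<forall>K. compact K \<and> K \<subseteq> S \<longrightarrow> f absolutely_integrable_on K)"

definition locally_bounded :: "('a::euclidean_space \<Rightarrow> real) \<Rightarrow> bool" where
  "locally_bounded f \<longleftrightarrow> (\<forall>K. compact K \<longrightarrow> bounded (f ` K))"

definition Linf_loc :: "(real \<Rightarrow> real) \<Rightarrow> bool" where
  "Linf_loc C \<longleftrightarrow>
     set_borel_measurable lebesgue {0..} C \<and>
     (\<forall>T\<ge>0. \<exists>M. AE t in lebesgue. t \<in> {0..T} \<longrightarrow> \<bar>C t\<bar> \<le> M)"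

primrec Ck :: "nat \<Rightarrow> ('b::euclidean_space \<Rightarrow> real) \<Rightarrow> bool" where
  "Ck 0 f \<longleftrightarrow> continuous_on UNIV f"
| "Ck (Suc k) f \<longleftrightarrow>
     (\<forall>x. f differentiable (at x)) \<and> (\<forall>v. Ck k (\<lambda>x. frechet_derivative f (at x) v))"

text \<open>Test functions: smooth, with compact support inside \<open>\<real>\<^sup>N \<times> (0,\<infinity>)\<close>.\<close>

definition test_fun :: "('a::euclidean_space \<times> real \<Rightarrow> real) \<Rightarrow> bool" where
  "test_fun \<phi> \<longleftrightarrow>
     (\<forall>k. Ck k \<phi>) \<and>
     compact (closure {p. \<phi> p \<noteq> 0}) \<and> closure {p. \<phi> p \<noteq> 0} \<subseteq> UNIV \<times> {0<..}"

text \<open>The pairing of the distribution \<open>f\<^sub>t\<close> with \<open>\<phi>\<close>, for \<open>f\<close> locally integrable in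
  \<open>\<real>\<^sup>N \<times> (0,\<infinity>)\<close>.\<close>

definition dt_pairing ::
  "('a::euclidean_space \<Rightarrow> real \<Rightarrow> real) \<Rightarrow> ('a \<times> real \<Rightarrow> real) \<Rightarrow> real" where
  "dt_pairing f \<phi> = - (LINT (x, t)|lebesgue. f x t * deriv (\<lambda>s. \<phi> (x, s)) t)"

definition has_dt ::
  "('a::euclidean_space \<Rightarrow> real \<Rightarrow> real) \<Rightarrow> ('a \<Rightarrow> real \<Rightarrow> real) \<Rightarrow> bool" where
  "has_dt f g \<longleftrightarrow>
     (\<forall>\<phi>. test_fun \<phi> \<longrightarrow> dt_pairing f \<phi> = (LINT (x, t)|lebesgue. g x t * \<phi> (x, t)))"

definition conv :: "('a::euclidean_space \<Rightarrow> real) \<Rightarrow> ('a \<Rightarrow> real) \<Rightarrow> 'a \<Rightarrow> real" where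
  "conv J f x = (LINT y|lebesgue. J (x - y) * f y)"

text \<open>\<open>J \<ast> u \<in> L\<^sup>1\<^sub>l\<^sub>o\<^sub>c(\<real>\<^sup>N \<times> (0,\<infinity>))\<close>. Since the Bochner integral of a
  non-integrable function is 0, convergence of the convolution integral at almost every point
  has to be stated separately.\<close>

definition conv_L1loc ::
  "('a::euclidean_space \<Rightarrow> real) \<Rightarrow> ('a \<Rightarrow> real \<Rightarrow> real) \<Rightarrow> bool" where
  "conv_L1loc J u \<longleftrightarrow>
     (AE (x, t) in lebesgue. 0 < t \<longrightarrow> integrable lebesgue (\<lambda>y. J (x - y) * u y t)) \<and>
     L1loc (UNIV \<times> {0<..}) (\<lambda>(x, t). conv J (\<lambda>y. u y t) x)"

text \<open>An element of \<open>C\<^sup>0([0,\<infinity>); L\<^sup>1\<^sub>l\<^sub>o\<^sub>c(\<real>\<^sup>N))\<close> is given by a function on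
  \<open>\<real>\<^sup>N \<times> [0,\<infinity>)\<close> (its values for \<open>t < 0\<close> play no role), two such functions being identified
  if for every \<open>t \<ge> 0\<close> their slices at time \<open>t\<close> agree almost everywhere.\<close>

definition cont_in_time_L1loc :: "('a::euclidean_space \<Rightarrow> real \<Rightarrow> real) \<Rightarrow> bool" where
  "cont_in_time_L1loc u \<longleftrightarrow>
     (\<forall>t\<ge>0. L1loc UNIV (\<lambda>x. u x t)) \<and>
     (\<forall>K. compact K \<longrightarrow> (\<forall>s\<ge>0.
        ((\<lambda>t. LINT x:K|lebesgue. \<bar>u x t - u x s\<bar>) \<longlongrightarrow> 0) (at s within {0..})))"

text \<open>Every element of \<open>C\<^sup>0([0,\<infinity>); L\<^sup>1\<^sub>l\<^sub>o\<^sub>c(\<real>\<^sup>N))\<close> has a representative that is locally integrable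
  jointly in \<open>(x, t)\<close>; the second conjunct selects such a representative. The derivative \<open>u\<^sub>t\<close> is
  the distributional one, represented by the locally integrable function \<open>g\<close>.\<close>

definition strong_solution ::
  "('a::euclidean_space \<Rightarrow> real) \<Rightarrow> ('a \<Rightarrow> real) \<Rightarrow> ('a \<Rightarrow> real \<Rightarrow> real) \<Rightarrow> bool" where
  "strong_solution J u0 u \<longleftrightarrow>
     cont_in_time_L1loc u \<and>
     L1loc (UNIV \<times> {0<..}) (\<lambda>(x, t). u x t) \<and>
     conv_L1loc J u \<and>
     (\<exists>g. L1loc (UNIV \<times> {0<..}) (\<lambda>(x, t). g x t) \<and> has_dt u g \<and>
          (AE (x, t) in lebesgue. 0 < t \<longrightarrow> g x t = conv J (\<lambda>y. u y t) x - u x t)) \<and>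
     (AE x in lebesgue. u x 0 = u0 x)"

text \<open>The inequality \<open>\<psi>\<^sub>t \<ge> J \<ast> \<psi> - \<psi>\<close> in the sense of distributions on \<open>\<real>\<^sup>N \<times> (0,\<infinity>)\<close>. No
  regularity of \<open>\<psi>\<^sub>t\<close> is assumed, so inequalities holding almost everywhere with
  \<open>\<psi>\<^sub>t \<in> L\<^sup>1\<^sub>l\<^sub>o\<^sub>c\<close> are covered.\<close>

definition supersolution ::
  "('a::euclidean_space \<Rightarrow> real) \<Rightarrow> ('a \<Rightarrow> real \<Rightarrow> real) \<Rightarrow> bool" where
  "supersolution J \<psi> \<longleftrightarrow>
     conv_L1loc J \<psi> \<and>
     (\<forall>\<phi>. test_fun \<phi> \<and> (\<forall>p. 0 \<le> \<phi> p) \<longrightarrow>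
        dt_pairing \<psi> \<phi> \<ge>
          (LINT (x, t)|lebesgue. (conv J (\<lambda>y. \<psi> y t) x - \<psi> x t) * \<phi> (x, t)))"

text \<open>\<open>u \<lless> v\<close> locally uniformly in \<open>[0,\<infinity>)\<close>. The inequality is required almost everywhere, since it
  is applied to \<open>u\<close> defined up to null sets; this is implied by the inequality at every point.\<close>

definition ll_loc_unif ::
  "('a::euclidean_space \<Rightarrow> real \<Rightarrow> real) \<Rightarrow> ('a \<Rightarrow> real \<Rightarrow> real) \<Rightarrow> bool" where
  "ll_loc_unif u v \<longleftrightarrow>
     (\<exists>C \<epsilon>. Linf_loc C \<and> (\<epsilon> \<longlongrightarrow> 0) at_infinity \<and>
        (AE (x, t) in lebesgue. 0 \<le> t \<longrightarrow> \<bar>u x t\<bar> \<le> C t * \<epsilon> x * \<bar>v x t\<bar>))"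

end

theory Submission
  imports Defs
begin

text \<open>
  Let \<open>w = u - v\<close> be the difference of two solutions and \<open>\<delta> > 0\<close>. The idea is to compare
  \<open>\<bar>w\<bar>\<close> with the small multiple \<open>\<delta> \<psi>\<close> of the supersolution, and to let \<open>\<delta>\<close> tend to 0.

  Multiplication by \<open>e\<^sup>t\<close> removes the zeroth order term: for almost every \<open>x\<close> the function
  \<open>e\<^sup>t w(x, t)\<close> has the time derivative \<open>e\<^sup>t (J \<ast> w)(x, t)\<close>, and \<open>e\<^sup>t \<psi>\<close> grows at
  least as fast as the corresponding integral. Hence \<open>h = \<bar>w\<bar> - \<delta> \<psi>\<close> satisfies
  \<open>e\<^sup>t h(x, t) \<le> e\<^sup>c \<bar>w(x, c)\<bar> + \<integral> e\<^sup>s (J \<ast> h\<^sup>+)(x, s) ds\<close>, the integral being taken over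
  \<open>c < s < t\<close> (lemma \<open>difference_pointwise_ineq\<close>). The growth condition says that \<open>h \<le> 0\<close> outside a large
  ball \<open>K\<close>, on any bounded time interval. So \<open>h\<^sup>+\<close> lives on \<open>K\<close>, and integrating over
  \<open>K\<close> while using \<open>\<integral> J = 1\<close> and \<open>w(0) = 0\<close>, in the limit \<open>c \<rightarrow> 0\<close>, gives
  \<open>H(t) \<le> \<integral> H(s) ds\<close> over \<open>0 < s < t\<close>, for the finite quantity \<open>H(t) = e\<^sup>t \<integral> h\<^sup>+(x, t) dx\<close>.
  Gronwall's lemma yields \<open>h\<^sup>+ = 0\<close>, that is \<open>\<bar>w\<bar> \<le> \<delta> \<psi>\<close>
  (lemma \<open>comparison_on_compact\<close>).

  The work lies in getting from the distributional formulation to a statement about almost every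
  \<open>x\<close>. Testing with products of a smooth approximation of the indicator of a box and a smooth
  approximation of \<open>e\<^sup>t\<close> on a time interval turns the differential inequality into an
  integrated inequality over every box (\<open>supersolution_box_ineq\<close>), and a function whose
  integrals over all boxes are nonnegative is nonnegative almost everywhere
  (\<open>AE_nonneg_if_cbox_integrals_nonneg\<close>). This argument applies to \<open>\<psi>\<close> and, since
  solutions are supersolutions together with their negatives, to \<open>u\<close> and \<open>v\<close>. After that
  step all estimates are written with integrals of nonnegative extended functions. This is what
  allows the limit \<open>c \<rightarrow> 0\<close>: the convolutions are known to be locally integrable only for
  positive times.
\<close>

section \<open>Smooth functions\<close>

lemma Ck_Suc_imp_Ck: "Ck (Suc k) f \<Longrightarrow> Ck k f"
proof (induction k arbitrary: f)
  case 0
  then show ?case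
    by (auto intro!: continuous_at_imp_continuous_on differentiable_imp_continuous_within)
next
  case (Suc k)
  then show ?case by (metis Ck.simps(2))
qed

lemma Ck_const: "Ck k (\<lambda>x. c)"
  by (induction k arbitrary: c) (auto simp: frechet_derivative_const)

text \<open>
  Derivatives being unique, one obtained from the usual differentiation rules may replace
  the choice made by \<open>frechet_derivative\<close>.
\<close>

lemma Ck_SucI:
  assumes "\<And>x. (f has_derivative f' x) (at x)" and "\<And>v. Ck k (\<lambda>x. f' x v)"
  shows "Ck (Suc k) f"
proof -
  have "frechet_derivative f (at x) = f' x" for x
    using frechet_derivative_at[OF assms(1)] by simp
  then show ?thesis
    using assms by (auto simp: differentiable_def)
qed

lemma Ck_SucD:
  assumes "Ck (Suc k) f"
  shows "(f has_derivative frechet_derivative f (at x)) (at x)"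
    and "Ck k (\<lambda>x. frechet_derivative f (at x) v)"
  using assms by (auto simp: frechet_derivative_works[symmetric])

lemma Ck_add: "Ck k f \<Longrightarrow> Ck k g \<Longrightarrow> Ck k (\<lambda>x. f x + g x)"
proof (induction k arbitrary: f g)
  case 0
  then show ?case by (auto intro: continuous_on_add)
next
  case (Suc k)
  show ?case
    by (rule Ck_SucI[OF has_derivative_add[OF Ck_SucD(1)[OF Suc.prems(1)] Ck_SucD(1)[OF Suc.prems(2)]]])
       (rule Suc.IH[OF Ck_SucD(2)[OF Suc.prems(1)] Ck_SucD(2)[OF Suc.prems(2)]])
qed

lemma Ck_mult: "Ck k f \<Longrightarrow> Ck k g \<Longrightarrow> Ck k (\<lambda>x. f x * g x)"
proof (induction k arbitrary: f g)
  case 0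
  then show ?case by (auto intro: continuous_on_mult)
next
  case (Suc k)
  show ?case
    by (rule Ck_SucI[OF has_derivative_mult[OF Ck_SucD(1)[OF Suc.prems(1)] Ck_SucD(1)[OF Suc.prems(2)]]])
       (intro Ck_add Suc.IH Ck_SucD(2)[OF Suc.prems(1)] Ck_SucD(2)[OF Suc.prems(2)]
         Ck_Suc_imp_Ck[OF Suc.prems(1)] Ck_Suc_imp_Ck[OF Suc.prems(2)])
qed

lemma Ck_prod:
  assumes "finite I" and "\<And>i. i \<in> I \<Longrightarrow> Ck k (f i)"
  shows "Ck k (\<lambda>x. \<Prod>i\<in>I. f i x)"
  using assms by (induction I rule: finite_induct) (auto intro: Ck_const Ck_mult)

lemma has_derivative_comp_affine:
  fixes a :: "'b::euclidean_space"
  assumes "(G has_real_derivative G') (at (a \<bullet> x + b))"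
  shows "((\<lambda>x. G (a \<bullet> x + b)) has_derivative (\<lambda>v. (a \<bullet> v) * G')) (at x)"
proof -
  have "((\<lambda>x. a \<bullet> x + b) has_derivative (\<lambda>v. a \<bullet> v)) (at x)"
    by (auto intro!: derivative_eq_intros)
  from has_derivative_compose[OF this assms[unfolded has_field_derivative_def]]
  show ?thesis by (simp add: mult.commute)
qed

lemma Ck_exp_affine: "Ck k (\<lambda>x. exp (a \<bullet> x + b))"
proof (induction k)
  case 0
  then show ?case by (auto intro!: continuous_intros)
next
  case (Suc k)
  show ?case
    by (rule Ck_SucI[OF has_derivative_comp_affine[OF DERIV_exp]]) (intro Ck_mult Ck_const Suc)
qed

text \<open>
  The classical smooth function \<open>exp (- 1 / t)\<close> that vanishes with all its derivatives at 0,
  together with its quotients by powers of \<open>t\<close>, which make the family closed under differentiation.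
\<close>

definition flat :: "nat \<Rightarrow> real \<Rightarrow> real" where
  "flat n t = (if 0 < t then exp (- (1 / t)) / t ^ n else 0)"

lemma flat_nonpos: "t \<le> 0 \<Longrightarrow> flat n t = 0"
  by (simp add: flat_def)

lemma flat_nonneg: "0 \<le> flat n t"
  by (simp add: flat_def)

lemma flat_0_le_1: "flat 0 t \<le> 1"
  by (simp add: flat_def)

lemma tendsto_flat_at_right_0: "(flat n \<longlongrightarrow> 0) (at_right 0)"
proof -
  have "((\<lambda>t::real. inverse t ^ n / exp (inverse t)) \<longlongrightarrow> 0) (at_right 0)"
    by (rule filterlim_compose[OF tendsto_power_div_exp_0 filterlim_inverse_at_top_right])
  moreover have "eventually (\<lambda>t::real. inverse t ^ n / exp (inverse t) = flat n t) (at_right 0)"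
    unfolding eventually_at_right_field
    by (intro exI[of _ 1]) (auto simp: flat_def exp_minus field_simps)
  ultimately show ?thesis
    by (rule Lim_transform_eventually)
qed

text \<open>
  Only \<open>t = 0\<close> is not routine: there the difference quotient of \<open>flat n\<close> is
  \<open>flat (n + 1)\<close>, which tends to 0.
\<close>

lemma DERIV_flat: "(flat n has_real_derivative flat (n + 2) t - real n * flat (n + 1) t) (at t)"
proof (cases "t = 0")
  case False
  show ?thesis
  proof (cases "0 < t")
    case True
    have "((\<lambda>t. exp (- (1 / t)) / t ^ n) has_real_derivative
        (exp (- (1 / t)) * (1 / t^2) * t ^ n - exp (- (1 / t)) * (real n * t ^ (n - 1))) / (t ^ n * t ^ n)) (at t)"
      using True by (auto intro!: derivative_eq_intros simp: power2_eq_square)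
    also have "(exp (- (1 / t)) * (1 / t^2) * t ^ n - exp (- (1 / t)) * (real n * t ^ (n - 1))) / (t ^ n * t ^ n)
      = flat (n + 2) t - real n * flat (n + 1) t"
      using True by (cases n) (auto simp: flat_def field_simps power2_eq_square)
    finally show ?thesis
      by (rule DERIV_cong_ev[OF refl _ refl, THEN iffD1, rotated])
         (use True in \<open>auto simp: flat_def eventually_nhds intro!: exI[of _ "{0<..}"]\<close>)
  next
    case False
    with \<open>t \<noteq> 0\<close> have t: "t < 0" by simp
    have "((\<lambda>_. 0) has_real_derivative flat (n + 2) t - real n * flat (n + 1) t) (at t)"
      using t by (auto simp: flat_nonpos)
    then show ?thesis
      by (rule DERIV_cong_ev[OF refl _ refl, THEN iffD1, rotated])
         (use t in \<open>auto simp: flat_def eventually_nhds intro!: exI[of _ "{..<0}"]\<close>)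
  qed
next
  case True
  have "((\<lambda>y. (flat n y - flat n 0) / (y - 0)) \<longlongrightarrow> 0) (at 0)"
  proof (subst at_eq_sup_left_right, rule filterlim_sup)
    show "((\<lambda>y. (flat n y - flat n 0) / (y - 0)) \<longlongrightarrow> 0) (at_left 0)"
      by (rule tendsto_eventually) (auto simp: flat_nonpos eventually_at_left_field intro!: exI[of _ "-1"])
    have "eventually (\<lambda>y. flat (n + 1) y = (flat n y - flat n 0) / (y - 0)) (at_right 0)"
      unfolding eventually_at_right_field by (intro exI[of _ 1]) (auto simp: flat_def)
    then show "((\<lambda>y. (flat n y - flat n 0) / (y - 0)) \<longlongrightarrow> 0) (at_right 0)"
      by (rule Lim_transform_eventually[OF tendsto_flat_at_right_0])
  qed
  then show ?thesis
    using True by (simp add: has_field_derivative_iff flat_nonpos)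
qed

lemma continuous_on_flat: "continuous_on A (flat n)"
  by (meson DERIV_flat DERIV_isCont continuous_at_imp_continuous_on)

lemma Ck_flat_affine: "Ck k (\<lambda>x. flat n (a \<bullet> x + b))"
proof (induction k arbitrary: n)
  case 0
  show ?case
    by (auto intro!: continuous_intros continuous_on_compose2[OF continuous_on_flat[of UNIV n]])
next
  case (Suc k)
  have *: "Ck k (\<lambda>x. (a \<bullet> v) * (flat (n + 2) (a \<bullet> x + b) + (- real n) * flat (n + 1) (a \<bullet> x + b)))" for v
    by (intro Ck_mult Ck_const Ck_add Suc)
  show ?case
    by (rule Ck_SucI[OF has_derivative_comp_affine[OF DERIV_flat]]) (use * in simp)
qed

lemma flat_scaled_tendsto:
  assumes "0 < t" shows "(\<lambda>m. flat 0 (real m * t)) \<longlonglongrightarrow> 1"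
proof -
  have "(\<lambda>m. exp (- (inverse (real m) * inverse t))) \<longlonglongrightarrow> exp (- (0 * inverse t))"
    by (intro tendsto_intros LIMSEQ_inverse_real_of_nat lim_inverse_n)
  moreover have "eventually (\<lambda>m. exp (- (inverse (real m) * inverse t)) = flat 0 (real m * t)) sequentially"
    using eventually_gt_at_top[of 0]
    by eventually_elim (use assms in \<open>auto simp: flat_def field_simps\<close>)
  ultimately show ?thesis
    using Lim_transform_eventually by fastforce
qed

text \<open>
  As the derivative of \<open>flat 0\<close>, which increases from 0 to 1, the function \<open>flat 2\<close> has total
  mass 1; rescaled copies of it will approximate the Dirac measure.
\<close>

lemma flat_2_integral: "has_bochner_integral lborel (flat 2) 1"
proof -
  have lim: "(flat 0 \<longlongrightarrow> 1) at_top"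
  proof -
    have "((\<lambda>t. exp (- inverse t)) \<longlongrightarrow> exp (- (0::real))) at_top"
      by (intro tendsto_intros tendsto_inverse_0_at_top filterlim_ident)
    moreover have "eventually (\<lambda>t. exp (- inverse t) = flat 0 t) at_top"
      using eventually_gt_at_top[of 0] by eventually_elim (auto simp: flat_def field_simps)
    ultimately show ?thesis using Lim_transform_eventually by fastforce
  qed
  have "(\<integral>\<^sup>+x. ennreal (flat 2 x) * indicator {0..} x \<partial>lborel) = ennreal (1 - flat 0 0)"
    by (rule nn_integral_FTC_atLeast[where F = "flat 0"])
       (use lim DERIV_flat[of 0] in
         \<open>auto simp: flat_nonneg numeral_2_eq_2 intro!: borel_measurable_continuous_onI continuous_on_flat\<close>)
  moreover have "(\<lambda>x. ennreal (flat 2 x) * indicator {0..} x) = (\<lambda>x. ennreal (flat 2 x))"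
    by (auto simp: flat_nonpos indicator_def fun_eq_iff)
  ultimately have "(\<integral>\<^sup>+x. ennreal (flat 2 x) \<partial>lborel) = ennreal 1"
    by (simp add: flat_nonpos)
  then show ?thesis
    by (intro has_bochner_integral_nn_integral)
       (auto simp: flat_nonneg intro!: borel_measurable_continuous_onI continuous_on_flat)
qed

section \<open>Test functions approximating boxes and time intervals\<close>

definition space_bump :: "'a::euclidean_space \<Rightarrow> 'a \<Rightarrow> nat \<Rightarrow> 'a \<Rightarrow> real" where
  "space_bump a b n x =
     (\<Prod>i\<in>Basis. flat 0 (real n * (x \<bullet> i - a \<bullet> i)) * flat 0 (real n * (b \<bullet> i - x \<bullet> i)))"

definition time_bump :: "real \<Rightarrow> real \<Rightarrow> nat \<Rightarrow> real \<Rightarrow> real" where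
  "time_bump c d m t = flat 0 (real m * (t - c)) * flat 0 (real m * (d - t))"

text \<open>
  The derivative of the cutoff \<open>time_bump c d m\<close> is a difference of two copies of this
  kernel, with \<open>L = d - c\<close>: one is concentrated just after \<open>c\<close>, and its mirror image just before \<open>d\<close>.
\<close>

definition edge_kernel :: "real \<Rightarrow> nat \<Rightarrow> real \<Rightarrow> real" where
  "edge_kernel L m t = real m * flat 2 (real m * t) * flat 0 (real m * (L - t))"

lemma flat_mult_pos: "flat k (real m * t) \<noteq> 0 \<Longrightarrow> 0 < t"
  by (metis flat_nonpos linorder_not_le mult_nonneg_nonpos of_nat_0_le_iff)

lemma space_bump_bounds: "0 \<le> space_bump a b n x" "space_bump a b n x \<le> indicator (box a b) x"
proof -
  show "0 \<le> space_bump a b n x"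
    by (auto simp: space_bump_def flat_nonneg intro!: prod_nonneg)
  show "space_bump a b n x \<le> indicator (box a b) x"
  proof (cases "x \<in> box a b")
    case True
    have "space_bump a b n x \<le> 1"
      unfolding space_bump_def
      by (intro prod_le_1) (auto simp: flat_nonneg flat_0_le_1 mult_le_one)
    then show ?thesis using True by simp
  next
    case False
    then obtain i where i: "i \<in> Basis" and "\<not> (0 < x \<bullet> i - a \<bullet> i \<and> 0 < b \<bullet> i - x \<bullet> i)"
      by (auto simp: mem_box)
    then have "flat 0 (real n * (x \<bullet> i - a \<bullet> i)) * flat 0 (real n * (b \<bullet> i - x \<bullet> i)) = 0"
      using flat_mult_pos[of 0 n "x \<bullet> i - a \<bullet> i"] flat_mult_pos[of 0 n "b \<bullet> i - x \<bullet> i"] by fastforce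
    with i have "\<exists>i\<in>Basis. flat 0 (real n * (x \<bullet> i - a \<bullet> i)) * flat 0 (real n * (b \<bullet> i - x \<bullet> i)) = 0"
      by (rule bexI[rotated])
    then have "space_bump a b n x = 0"
      unfolding space_bump_def by (intro prod_zero finite_Basis)
    then show ?thesis by simp
  qed
qed

lemma space_bump_tendsto: "(\<lambda>n. space_bump a b n x) \<longlonglongrightarrow> indicator (box a b) x"
proof (cases "x \<in> box a b")
  case True
  have "(\<lambda>n. space_bump a b n x) \<longlonglongrightarrow> (\<Prod>i\<in>(Basis::'a set). 1 * 1)"
    unfolding space_bump_def
    by (intro tendsto_prod tendsto_mult flat_scaled_tendsto) (use True in \<open>auto simp: mem_box\<close>)
  then show ?thesis using True by simp
next
  case False
  then have "space_bump a b n x = 0" for n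
    using space_bump_bounds[of a b n x] by simp
  then show ?thesis using False by simp
qed

lemma time_bump_bounds: "0 \<le> time_bump c d m t" "time_bump c d m t \<le> indicator {c<..<d} t"
proof -
  show "0 \<le> time_bump c d m t" by (simp add: time_bump_def flat_nonneg)
  show "time_bump c d m t \<le> indicator {c<..<d} t"
  proof (cases "t \<in> {c<..<d}")
    case True
    then show ?thesis
      by (simp add: time_bump_def flat_nonneg flat_0_le_1 mult_le_one)
  next
    case False
    then have "time_bump c d m t = 0"
      using flat_mult_pos[of 0 m "t - c"] flat_mult_pos[of 0 m "d - t"]
      by (auto simp: time_bump_def)
    then show ?thesis by simp
  qed
qed

lemma time_bump_tendsto: "(\<lambda>m. time_bump c d m t) \<longlonglongrightarrow> indicator {c<..<d} t"
proof (cases "t \<in> {c<..<d}")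
  case True
  have "(\<lambda>m. time_bump c d m t) \<longlonglongrightarrow> 1 * 1"
    unfolding time_bump_def
    by (intro tendsto_mult flat_scaled_tendsto) (use True in auto)
  then show ?thesis using True by simp
next
  case False
  then have "time_bump c d m t = 0" for m
    using time_bump_bounds[of c d m t] by simp
  then show ?thesis using False by simp
qed

lemma continuous_on_flat_comp [continuous_intros]:
  "continuous_on A f \<Longrightarrow> continuous_on A (\<lambda>x. flat n (f x))"
  by (rule continuous_on_compose2[OF continuous_on_flat[of UNIV n]]) auto

lemma borel_measurable_flat [measurable]: "flat n \<in> borel_measurable borel"
  by (intro borel_measurable_continuous_onI continuous_on_flat)

lemma borel_measurable_bumps [measurable]:
  "space_bump a b n \<in> borel_measurable borel"
  "time_bump c d m \<in> borel_measurable borel"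
  "edge_kernel L m \<in> borel_measurable borel"
  unfolding space_bump_def time_bump_def edge_kernel_def
  by (intro borel_measurable_continuous_onI continuous_intros)+

lemma DERIV_time_bump:
  "(time_bump c d m has_real_derivative
      edge_kernel (d - c) m (t - c) - edge_kernel (d - c) m (d - t)) (at t)"
proof -
  have *: "(flat 0 has_real_derivative flat 2 s) (at s)" for s
    using DERIV_flat[of 0 s] by (simp add: numeral_2_eq_2)
  have "((\<lambda>t. flat 0 (real m * (t - c)) * flat 0 (real m * (d - t))) has_real_derivative
      (flat 2 (real m * (t - c)) * real m) * flat 0 (real m * (d - t))
      + (flat 2 (real m * (d - t)) * (- real m)) * flat 0 (real m * (t - c))) (at t)"
    by (rule DERIV_mult; rule DERIV_chain2[OF *]) (auto intro!: derivative_eq_intros)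
  moreover have "d - c - (t - c) = d - t" "d - c - (d - t) = t - c" by auto
  ultimately show ?thesis
    unfolding time_bump_def[abs_def] edge_kernel_def by (simp add: algebra_simps)
qed

lemma test_fun_bump:
  fixes a b :: "'a::euclidean_space"
  assumes "0 < c"
  shows "test_fun (\<lambda>(x, t). space_bump a b n x * (exp t * time_bump c d m t))"
    (is "test_fun ?\<phi>")
  unfolding test_fun_def
proof (intro conjI allI)
  fix k
  have sp: "Ck k (\<lambda>p::'a \<times> real. flat 0 (real n * (fst p \<bullet> i - s)))" for i s
    using Ck_flat_affine[of k 0 "(real n *\<^sub>R i, 0)" "- real n * s"]
    by (simp add: inner_prod_def algebra_simps inner_commute)
  have sm: "Ck k (\<lambda>p::'a \<times> real. flat 0 (real n * (s - fst p \<bullet> i)))" for i s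
    using Ck_flat_affine[of k 0 "(- real n *\<^sub>R i, 0)" "real n * s"]
    by (simp add: inner_prod_def algebra_simps inner_commute)
  have tp: "Ck k (\<lambda>p::'a \<times> real. flat 0 (real m * (snd p - s)))" for s
    using Ck_flat_affine[of k 0 "(0, real m)" "- real m * s"]
    by (simp add: inner_prod_def algebra_simps)
  have tm: "Ck k (\<lambda>p::'a \<times> real. flat 0 (real m * (s - snd p)))" for s
    using Ck_flat_affine[of k 0 "(0, - real m)" "real m * s"]
    by (simp add: inner_prod_def algebra_simps)
  have e: "Ck k (\<lambda>p::'a \<times> real. exp (snd p))"
    using Ck_exp_affine[of k "(0::'a, 1::real)" 0] by (simp add: inner_prod_def)
  show "Ck k ?\<phi>"
    unfolding space_bump_def time_bump_def case_prod_beta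
    by (intro Ck_mult Ck_prod sp sm tp tm e finite_Basis)
next
  have "{p. ?\<phi> p \<noteq> 0} \<subseteq> cbox a b \<times> {c..d}"
  proof (clarsimp)
    fix x t assume *: "space_bump a b n x \<noteq> 0" "time_bump c d m t \<noteq> 0"
    from *(1) have "x \<in> box a b"
      using space_bump_bounds[of a b n x] by (cases "x \<in> box a b") auto
    moreover from *(2) have "t \<in> {c<..<d}"
      using time_bump_bounds[of c d m t] by (cases "t \<in> {c<..<d}") auto
    ultimately show "x \<in> cbox a b \<and> c \<le> t \<and> t \<le> d"
      using box_subset_cbox by auto
  qed
  then have *: "closure {p. ?\<phi> p \<noteq> 0} \<subseteq> cbox a b \<times> {c..d}"
    by (intro closure_minimal closed_Times) auto
  show "compact (closure {p. ?\<phi> p \<noteq> 0})"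
    using compact_Int_closed[of "cbox a b \<times> {c..d}" "closure {p. ?\<phi> p \<noteq> 0}"] *
    by (simp add: compact_Times inf.absorb2)
  show "closure {p. ?\<phi> p \<noteq> 0} \<subseteq> UNIV \<times> {0<..}"
    using assms by (intro order_trans[OF *]) auto
qed

text \<open>
  In the variable \<open>s = m t\<close> the kernel becomes \<open>flat 2 s\<close>, of mass 1, times
  \<open>flat 0 (m L - s)\<close>, which tends to 1; meanwhile \<open>G (s / m)\<close> tends to \<open>G 0\<close>. The function
  \<open>flat 2\<close> itself dominates the integrands.
\<close>

lemma edge_kernel_approximates_delta:
  assumes "0 < L" and G: "continuous_on {0..L} G"
  shows "(\<lambda>m. LINT t|lborel. edge_kernel L m t * G t) \<longlonglongrightarrow> G 0"
proof -
  \<comment> \<open>The kernel vanishes outside \<open>[0, L]\<close>, so \<open>G\<close> may be continued by constants.\<close>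
  define G' where "G' t = G (max 0 (min L t))" for t
  have G'_cont: "continuous_on UNIV G'"
    unfolding G'_def
    by (rule continuous_on_compose2[OF G]) (use \<open>0 < L\<close> in \<open>auto intro!: continuous_intros\<close>)
  then have [measurable]: "G' \<in> borel_measurable borel"
    by (rule borel_measurable_continuous_onI)
  have "bounded (G ` {0..L})"
    using compact_continuous_image[OF G compact_Icc] by (rule compact_imp_bounded)
  then obtain B where "\<forall>y\<in>G ` {0..L}. norm y \<le> B"
    unfolding bounded_iff by (elim exE)
  then have B: "\<bar>G t\<bar> \<le> B" if "t \<in> {0..L}" for t
    using that by simp
  have B': "\<bar>G' t\<bar> \<le> B" for t
    unfolding G'_def using \<open>0 < L\<close> by (intro B) auto
  have "0 \<le> B" using B[of 0] \<open>0 < L\<close> by auto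
  have eq: "edge_kernel L m t * G t = edge_kernel L m t * G' t" for m t
    using flat_mult_pos[of 2 m t] flat_mult_pos[of 0 m "L - t"]
    by (cases "edge_kernel L m t = 0") (auto simp: edge_kernel_def G'_def)
  let ?g = "\<lambda>m s. flat 2 s * flat 0 (real m * L - s) * G' (s / real m)"
  have flat2: "integrable lborel (flat 2)" "integral\<^sup>L lborel (flat 2) = 1"
    using flat_2_integral by (auto simp: has_bochner_integral_iff)
  have lim: "(\<lambda>m. LINT s|lborel. ?g m s) \<longlonglongrightarrow> (LINT s|lborel. flat 2 s * G' 0)"
  proof (rule integral_dominated_convergence[where w = "\<lambda>s. B * flat 2 s"])
    show "integrable lborel (\<lambda>s. B * flat 2 s)" using flat2 by simp
    show "AE s in lborel. norm (?g m s) \<le> B * flat 2 s" for m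
    proof (rule AE_I2)
      fix s
      have "flat 0 (real m * L - s) * \<bar>G' (s / real m)\<bar> \<le> 1 * B"
        by (intro mult_mono) (auto simp: flat_nonneg flat_0_le_1 B' \<open>0 \<le> B\<close>)
      then have "flat 2 s * (flat 0 (real m * L - s) * \<bar>G' (s / real m)\<bar>) \<le> flat 2 s * B"
        by (intro mult_left_mono) (auto simp: flat_nonneg)
      then show "norm (?g m s) \<le> B * flat 2 s"
        by (simp add: abs_mult flat_nonneg mult_ac)
    qed
    show "AE s in lborel. (\<lambda>m. ?g m s) \<longlonglongrightarrow> flat 2 s * G' 0"
    proof (rule AE_I2)
      fix s
      have top: "filterlim (\<lambda>m. - s + real m * L) at_top sequentially"
        by (intro filterlim_tendsto_add_at_top[OF tendsto_const] filterlim_at_top_mult_tendsto_pos[OF tendsto_const \<open>0 < L\<close>]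
              filterlim_real_sequentially)
      have "(\<lambda>m. exp (- inverse (- s + real m * L))) \<longlonglongrightarrow> exp (- 0)"
        by (intro tendsto_exp tendsto_minus tendsto_inverse_0_at_top top)
      moreover have "eventually (\<lambda>m. 0 < - s + real m * L) sequentially"
        using top unfolding filterlim_at_top_dense by blast
      then have "eventually (\<lambda>m. exp (- inverse (- s + real m * L)) = flat 0 (real m * L - s)) sequentially"
        by eventually_elim (simp add: flat_def inverse_eq_divide)
      ultimately have 1: "(\<lambda>m. flat 0 (real m * L - s)) \<longlonglongrightarrow> 1"
        using Lim_transform_eventually by fastforce
      have "(\<lambda>m. s / real m) \<longlonglongrightarrow> 0" by (rule lim_const_over_n)
      then have 2: "(\<lambda>m. G' (s / real m)) \<longlonglongrightarrow> G' 0"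
        using G'_cont by (auto intro: continuous_on_tendsto_compose)
      show "(\<lambda>m. ?g m s) \<longlonglongrightarrow> flat 2 s * G' 0"
        using tendsto_mult[OF tendsto_mult[OF tendsto_const[of "flat 2 s"] 1] 2] by simp
    qed
  qed measurable
  have "(LINT s|lborel. flat 2 s * G' 0) = G 0"
    using flat2 \<open>0 < L\<close> by (simp add: G'_def)
  with lim have "(\<lambda>m. LINT s|lborel. ?g m s) \<longlonglongrightarrow> G 0"
    by simp
  moreover have "eventually (\<lambda>m. (LINT s|lborel. ?g m s) = (LINT t|lborel. edge_kernel L m t * G t)) sequentially"
    using eventually_gt_at_top[of 0]
  proof eventually_elim
    fix m :: nat assume m: "0 < m"
    have "(LINT t|lborel. edge_kernel L m t * G' t)
        = \<bar>1 / real m\<bar> *\<^sub>R (LINT s|lborel. edge_kernel L m (0 + (1 / real m) * s) * G' (0 + (1 / real m) * s))"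
      by (rule lborel_integral_real_affine) (use m in auto)
    also have "\<dots> = \<bar>1 / real m\<bar> *\<^sub>R (LINT s|lborel. real m *\<^sub>R ?g m s)"
    proof (intro arg_cong[where f = "\<lambda>z. \<bar>1 / real m\<bar> *\<^sub>R z"] Bochner_Integration.integral_cong refl)
      fix s
      have "real m * (L - s / real m) = real m * L - s"
        using m by (simp add: right_diff_distrib)
      then show "edge_kernel L m (0 + (1 / real m) * s) * G' (0 + (1 / real m) * s) = real m *\<^sub>R ?g m s"
        using m by (simp add: edge_kernel_def)
    qed
    also have "\<dots> = (LINT s|lborel. ?g m s)"
      using m by (simp only: Bochner_Integration.integral_scaleR_right) simp
    finally show "(LINT s|lborel. ?g m s) = (LINT t|lborel. edge_kernel L m t * G t)"
      by (simp only: eq)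
  qed
  ultimately show ?thesis
    by (rule Lim_transform_eventually)
qed

section \<open>Functions with nonnegative integrals over boxes\<close>

text \<open>
  A finite union of boxes can be divided into boxes with disjoint interiors.
\<close>

lemma set_integral_finite_Union_cbox_nonneg:
  fixes f :: "'a::euclidean_space \<Rightarrow> real"
  assumes int: "\<And>a b. set_integrable lebesgue (cbox a b) f"
    and nonneg: "\<And>a b. 0 \<le> (LINT x:cbox a b|lebesgue. f x)"
    and "finite F" and F: "\<And>k. k \<in> F \<Longrightarrow> \<exists>a b. k = cbox a b"
  shows "0 \<le> (LINT x:\<Union>F|lebesgue. f x)"
proof -
  have "bounded (\<Union>F)"
    using \<open>finite F\<close> F by (auto intro!: bounded_Union) (metis bounded_cbox)
  then obtain c d where cd: "\<Union>F \<subseteq> cbox c d"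
    using bounded_subset_cbox_symmetric by metis
  have "\<Union>F \<in> sets lebesgue"
    using \<open>finite F\<close> F by (intro sets.finite_Union) (auto, metis lmeasurable_cbox fmeasurableD)
  then have intF: "set_integrable lebesgue (\<Union>F) f"
    using set_integrable_subset[OF int] cd by blast
  obtain p where p: "p division_of \<Union>F"
    using elementary_unions_intervals[OF \<open>finite F\<close> F] by metis
  have "integral (\<Union>F) f = (\<Sum>k\<in>p. integral k f)"
    by (rule integral_combine_division_topdown[OF set_lebesgue_integral_eq_integral(1)[OF intF] p])
  also have "0 \<le> \<dots>"
  proof (rule sum_nonneg)
    fix k assume "k \<in> p"
    then obtain a b where k: "k = cbox a b" using division_ofD(4)[OF p] by blast
    show "0 \<le> integral k f"
      using nonneg[of a b] set_lebesgue_integral_eq_integral(2)[OF int[of a b]] by (simp add: k)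
  qed
  finally show ?thesis
    using set_lebesgue_integral_eq_integral(2)[OF intF] by simp
qed

lemma set_integral_tendsto_dominated:
  fixes f :: "'a \<Rightarrow> real"
  assumes f: "set_integrable M B f" and S: "\<And>n. S n \<in> sets M" "\<And>n. S n \<subseteq> B" and "E \<in> sets M"
    and lim: "AE x in M. (\<lambda>n. indicator (S n) x :: real) \<longlonglongrightarrow> indicator E x" and "E \<subseteq> B"
  shows "(\<lambda>n. LINT x:S n|M. f x) \<longlonglongrightarrow> (LINT x:E|M. f x)"
  unfolding set_lebesgue_integral_def
proof (rule integral_dominated_convergence[where w = "\<lambda>x. \<bar>indicator B x * f x\<bar>"])
  show "(\<lambda>x. indicator E x *\<^sub>R f x) \<in> borel_measurable M"
    using set_integrable_subset[OF f \<open>E \<in> sets M\<close> \<open>E \<subseteq> B\<close>]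
    unfolding set_integrable_def by (rule borel_measurable_integrable)
  show "(\<lambda>x. indicator (S n) x *\<^sub>R f x) \<in> borel_measurable M" for n
    using set_integrable_subset[OF f S(1) S(2)]
    unfolding set_integrable_def by (rule borel_measurable_integrable)
  show "integrable M (\<lambda>x. \<bar>indicator B x * f x\<bar>)"
    using f by (simp add: set_integrable_def)
  show "AE x in M. (\<lambda>n. indicator (S n) x *\<^sub>R f x) \<longlonglongrightarrow> indicator E x *\<^sub>R f x"
    using lim by eventually_elim (intro tendsto_intros)
  show "AE x in M. norm (indicator (S n) x *\<^sub>R f x) \<le> \<bar>indicator B x * f x\<bar>" for n
    using S(2)[of n] by (intro AE_I2) (auto simp: indicator_def)
qed

lemma set_integral_open_nonneg:
  fixes f :: "'a::euclidean_space \<Rightarrow> real"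
  assumes int: "\<And>a b. set_integrable lebesgue (cbox a b) f"
    and nonneg: "\<And>a b. 0 \<le> (LINT x:cbox a b|lebesgue. f x)"
    and "open U" "bounded U"
  shows "0 \<le> (LINT x:U|lebesgue. f x)"
proof -
  obtain \<D> where \<D>: "countable \<D>" "\<And>k. k \<in> \<D> \<Longrightarrow> \<exists>a b. k = cbox a b" "\<Union>\<D> = U" "\<D> \<noteq> {}"
  proof -
    let ?I = "{f\<in>Basis \<rightarrow>\<^sub>E \<rat> \<times> \<rat>. cbox (\<Sum>(i::'a)\<in>Basis. fst (f i) *\<^sub>R i) (\<Sum>(i::'a)\<in>Basis. snd (f i) *\<^sub>R i) \<subseteq> U}"
    let ?D = "insert {} ((\<lambda>f. cbox (\<Sum>(i::'a)\<in>Basis. fst (f i) *\<^sub>R i) (\<Sum>(i::'a)\<in>Basis. snd (f i) *\<^sub>R i)) ` ?I)"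
    have "countable (Basis \<rightarrow>\<^sub>E (\<rat>::real set) \<times> (\<rat>::real set) :: ('a \<Rightarrow> real \<times> real) set)"
      by (intro countable_PiE) (auto intro: countable_SIGMA countable_rat)
    then have "countable ?I" by (rule countable_subset[rotated]) auto
    then have "countable ?D" by auto
    moreover have "\<exists>a b. k = cbox a b" if "k \<in> ?D" for k
      using that empty_as_interval by (auto simp del: box_eq_empty)
    moreover have "\<Union>?D = U" using open_UNION_cbox[OF \<open>open U\<close>] by auto
    ultimately show thesis by (intro that[of ?D]) auto
  qed
  let ?S = "\<lambda>n. \<Union>(from_nat_into \<D> ` {..n})"
  obtain c d where cd: "U \<subseteq> cbox c d"
    using \<open>bounded U\<close> bounded_subset_cbox_symmetric by metis
  have sub: "from_nat_into \<D> i \<in> \<D>" for i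
    using \<D>(4) by (rule from_nat_into)
  have S_U: "?S n \<subseteq> U" for n
    using sub \<D>(3) by blast
  have S_sets: "?S n \<in> sets lebesgue" for n
    by (intro sets.finite_Union) (use sub \<D>(2) in \<open>auto, metis lmeasurable_cbox fmeasurableD\<close>)
  have "(\<lambda>n. LINT x:?S n|lebesgue. f x) \<longlonglongrightarrow> (LINT x:U|lebesgue. f x)"
  proof (rule set_integral_tendsto_dominated[OF int[of c d] S_sets])
    show "?S n \<subseteq> cbox c d" for n using S_U cd by blast
    show "U \<in> sets lebesgue" using \<open>open U\<close> by (simp add: borel_open)
    show "AE x in lebesgue. (\<lambda>n. indicator (?S n) x :: real) \<longlonglongrightarrow> indicator U x"
    proof (rule AE_I2)
      fix x :: 'a
      show "(\<lambda>n. indicator (?S n) x :: real) \<longlonglongrightarrow> indicator U x"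
      proof (cases "x \<in> U")
        case True
        then obtain k where "k \<in> \<D>" "x \<in> k" using \<D>(3) by auto
        then obtain i where "x \<in> from_nat_into \<D> i"
          using from_nat_into_surj[OF \<D>(1)] by metis
        then have "eventually (\<lambda>n. indicator (?S n) x = (1::real)) sequentially"
          unfolding eventually_sequentially by (intro exI[of _ i]) (auto simp: indicator_def)
        then show ?thesis using True by (simp add: tendsto_eventually)
      next
        case False
        then have "x \<notin> ?S n" for n using S_U by blast
        then show ?thesis using False by simp
      qed
    qed
    show "U \<subseteq> cbox c d" by (rule cd)
  qed
  moreover have "0 \<le> (LINT x:?S n|lebesgue. f x)" for n
    by (rule set_integral_finite_Union_cbox_nonneg[OF int nonneg]) (use sub \<D>(2) in auto)
  ultimately show ?thesis
    by (blast intro: LIMSEQ_le_const)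
qed

lemma AE_if_AE_on_boxes:
  fixes P :: "'a::euclidean_space \<Rightarrow> bool"
  assumes "\<And>a b. AE x in lebesgue. x \<in> box a b \<longrightarrow> P x"
  shows "AE x in lebesgue. P x"
proof -
  have "AE x in lebesgue. \<forall>N::nat. x \<in> box (- (real N *\<^sub>R One)) (real N *\<^sub>R One) \<longrightarrow> P x"
    unfolding AE_all_countable using assms by (intro allI)
  then show ?thesis
  proof eventually_elim
    fix x :: 'a
    assume *: "\<forall>N::nat. x \<in> box (- (real N *\<^sub>R One)) (real N *\<^sub>R One) \<longrightarrow> P x"
    have "x \<in> (\<Union>i::nat. box (- (real i *\<^sub>R One)) (real i *\<^sub>R One))"
      unfolding UN_box_eq_UNIV by simp
    then show "P x" using * by blast
  qed
qed

text \<open>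
  Integrals over open sets are nonnegative too, as limits of integrals over finite unions of
  boxes. By outer regularity they control the integral over the set \<open>E\<close> where \<open>f < 0\<close> inside a
  given box, which is therefore nonnegative; so \<open>E\<close> is a null set.
\<close>

lemma AE_nonneg_if_cbox_integrals_nonneg:
  fixes f :: "'a::euclidean_space \<Rightarrow> real"
  assumes int: "\<And>a b. set_integrable lebesgue (cbox a b) f"
    and nonneg: "\<And>a b. 0 \<le> (LINT x:cbox a b|lebesgue. f x)"
  shows "AE x in lebesgue. 0 \<le> f x"
proof (rule AE_if_AE_on_boxes)
  fix a b :: 'a
  show "AE x in lebesgue. x \<in> box a b \<longrightarrow> 0 \<le> f x"
  proof -
    define E where "E = {x \<in> box a b. f x < 0}"
    have box: "box a b \<subseteq> cbox a b" by (rule box_subset_cbox)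
    have E_sets: "E \<in> sets lebesgue"
    proof -
      have [measurable]: "(\<lambda>x. indicator (cbox a b) x *\<^sub>R f x) \<in> borel_measurable lebesgue"
        using int[of a b] unfolding set_integrable_def by (rule borel_measurable_integrable)
      have "E = box a b \<inter> {x \<in> space lebesgue. indicator (cbox a b) x *\<^sub>R f x < 0}"
        using box by (auto simp: E_def indicator_def)
      also have "\<dots> \<in> sets lebesgue"
        by (intro sets.Int) (simp, measurable)
      finally show ?thesis .
    qed
    have "\<exists>T. open T \<and> E \<subseteq> T \<and> emeasure lebesgue (T - E) < ennreal (inverse (Suc n)) \<and> T - E \<in> sets lebesgue" for n
      using sets_lebesgue_outer_open[OF E_sets, of "inverse (Suc n)"]
      by (metis fmeasurableD inverse_positive_iff_positive of_nat_0_less_iff zero_less_Suc)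
    then obtain T where T: "\<And>n. open (T n)" "\<And>n. E \<subseteq> T n"
      "\<And>n. emeasure lebesgue (T n - E) < ennreal (inverse (Suc n))" "\<And>n. T n - E \<in> sets lebesgue"
      by metis
    define U where "U n = box a b \<inter> (\<Inter>i\<le>n. T i)" for n
    have U: "open (U n)" "bounded (U n)" "U n \<subseteq> cbox a b" "E \<subseteq> U n" for n
      using T(1,2) box unfolding U_def E_def by (auto intro!: bounded_Int open_INT)
    \<comment> \<open>Decreasing the open sets \<open>U n\<close> recovers \<open>E\<close> up to a null set.\<close>
    have null: "emeasure lebesgue ((\<Inter>n. T n) - E) = 0"
    proof -
      have "emeasure lebesgue ((\<Inter>n. T n) - E) \<le> ennreal (inverse (Suc n))" for n
        by (rule order_trans[OF emeasure_mono less_imp_le[OF T(3)[of n]]]) (use T(4) in auto)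
      moreover have "(\<lambda>n. ennreal (inverse (Suc n))) \<longlonglongrightarrow> ennreal 0"
        by (intro tendsto_ennrealI LIMSEQ_inverse_real_of_nat)
      ultimately have "emeasure lebesgue ((\<Inter>n. T n) - E) \<le> ennreal 0"
        by (intro LIMSEQ_le_const) auto
      then show ?thesis by simp
    qed
    have "(\<Inter>n. T n) \<in> sets lebesgue"
      using T(1) by (intro sets.countable_INT) (auto simp: borel_open)
    then have "(\<Inter>n. T n) - E \<in> null_sets lebesgue"
      using null E_sets by auto
    then have ae: "AE x in lebesgue. x \<notin> (\<Inter>n. T n) - E" by (rule AE_not_in)
    have "(\<lambda>n. LINT x:U n|lebesgue. f x) \<longlonglongrightarrow> (LINT x:E|lebesgue. f x)"
    proof (rule set_integral_tendsto_dominated[OF int[of a b]])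
      show "AE x in lebesgue. (\<lambda>n. indicator (U n) x :: real) \<longlonglongrightarrow> indicator E x"
        using ae
      proof eventually_elim
        fix x assume x: "x \<notin> (\<Inter>n. T n) - E"
        show "(\<lambda>n. indicator (U n) x :: real) \<longlonglongrightarrow> indicator E x"
        proof (cases "x \<in> E")
          case True
          then have "x \<in> U n" for n using U(4) by blast
          then show ?thesis using True by simp
        next
          case False
          with x obtain i where "x \<notin> T i" by auto
          then have "eventually (\<lambda>n. indicator (U n) x = (0::real)) sequentially"
            unfolding eventually_sequentially U_def by (intro exI[of _ i]) (auto simp: indicator_def)
          then show ?thesis using False by (simp add: tendsto_eventually)
        qed
      qed
      show "E \<subseteq> cbox a b" using U(3,4) by blast
    qed (use U(1,3) E_sets in \<open>auto simp: borel_open\<close>)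
    moreover have "0 \<le> (LINT x:U n|lebesgue. f x)" for n
      by (rule set_integral_open_nonneg[OF int nonneg U(1,2)])
    ultimately have ge: "0 \<le> (LINT x:E|lebesgue. f x)"
      by (blast intro: LIMSEQ_le_const)
    have intE: "integrable lebesgue (\<lambda>x. - (indicator E x *\<^sub>R f x))"
      using set_integrable_subset[OF int[of a b] E_sets] U(3,4) unfolding set_integrable_def by auto
    have nn: "AE x in lebesgue. 0 \<le> - (indicator E x *\<^sub>R f x)"
      by (auto simp: E_def indicator_def)
    have "(LINT x|lebesgue. - (indicator E x *\<^sub>R f x)) = 0"
      using ge integral_nonneg_AE[OF nn] by (simp add: set_lebesgue_integral_def)
    then have "AE x in lebesgue. - (indicator E x *\<^sub>R f x) = 0"
      using integral_nonneg_eq_0_iff_AE[OF intE nn] by simp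
    then show ?thesis
      by eventually_elim (auto simp: E_def indicator_def split: if_splits)
  qed
qed

section \<open>Fubini for the completed Lebesgue measure\<close>

text \<open>
  Lebesgue measure on a product is the completion of a product measure, so null sets are
  enclosed in Borel null sets before they are sliced.
\<close>

lemma AE_lebesgue_pair:
  fixes P :: "'a::euclidean_space \<times> 'b::euclidean_space \<Rightarrow> bool"
  assumes "AE p in lebesgue. P p"
  shows "AE x in lebesgue. AE y in lebesgue. P (x, y)"
    and "AE y in lebesgue. AE x in lebesgue. P (x, y)"
proof -
  have "AE p in lborel \<Otimes>\<^sub>M lborel. P p"
    using assms unfolding lborel_prod by (simp add: AE_completion_iff)
  then obtain N where N: "N \<in> null_sets (lborel \<Otimes>\<^sub>M lborel)" "\<And>p. p \<notin> N \<Longrightarrow> P p"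
    by (auto simp: eventually_ae_filter lborel_prod)
  have AE_N: "AE p in lborel \<Otimes>\<^sub>M lborel. p \<notin> N"
    using N(1) by (rule AE_not_in)
  have meas: "{x \<in> space (lborel \<Otimes>\<^sub>M lborel). (\<lambda>(x::'a, y::'b). (x, y) \<notin> N) x} \<in> sets (lborel \<Otimes>\<^sub>M lborel)"
  proof -
    have "{x \<in> space (lborel \<Otimes>\<^sub>M lborel). (\<lambda>(x::'a, y::'b). (x, y) \<notin> N) x} = space (lborel \<Otimes>\<^sub>M lborel) - N"
      by auto
    moreover have "N \<in> sets (lborel \<Otimes>\<^sub>M lborel)" using N(1) by (rule null_setsD2)
    ultimately show ?thesis by (simp only: sets.compl_sets)
  qed
  have 1: "AE x in lborel. AE y in lborel. (x, y) \<notin> N"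
    using lborel_pair.AE_pair[OF AE_N] by simp
  then show "AE x in lebesgue. AE y in lebesgue. P (x, y)"
    using N(2) by (force simp: AE_completion_iff elim: eventually_mono)
  have "AE y in lborel. AE x in lborel. (x, y) \<notin> N"
    using lborel_pair.AE_commute[of "\<lambda>x y. (x, y) \<notin> N"] meas 1 by simp
  then show "AE y in lebesgue. AE x in lebesgue. P (x, y)"
    using N(2) by (force simp: AE_completion_iff elim: eventually_mono)
qed

text \<open>
  The function agrees almost everywhere with a Borel function, to which the theorem for the product
  of two Borel measures applies. Almost every slice is then a null modification of a Borel slice.
\<close>

lemma Fubini_lebesgue:
  fixes f :: "'a::euclidean_space \<times> 'b::euclidean_space \<Rightarrow> real"
  assumes f: "integrable lebesgue f"
  shows "AE x in lebesgue. integrable lebesgue (\<lambda>y. f (x, y))"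
    and "integrable lebesgue (\<lambda>x. LINT y|lebesgue. f (x, y))"
    and "(LINT x|lebesgue. LINT y|lebesgue. f (x, y)) = integral\<^sup>L lebesgue f"
    and "AE y in lebesgue. integrable lebesgue (\<lambda>x. f (x, y))"
    and "integrable lebesgue (\<lambda>y. LINT x|lebesgue. f (x, y))"
    and "(LINT y|lebesgue. LINT x|lebesgue. f (x, y)) = integral\<^sup>L lebesgue f"
proof -
  have f_meas: "f \<in> borel_measurable lebesgue" using f by auto
  obtain g where g: "g \<in> borel_measurable lborel" and "AE p in lborel. f p = g p"
    using completion_ex_borel_measurable_real[OF f_meas] by blast
  then have fg: "AE p in lebesgue. f p = g p" by (simp add: AE_completion_iff)
  have g_leb: "g \<in> borel_measurable lebesgue" using g by (rule measurable_completion)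
  have "integrable lebesgue g"
    using integrable_cong_AE[OF f_meas g_leb fg] f by simp
  then have int_g: "integrable (lborel \<Otimes>\<^sub>M lborel) (\<lambda>(x, y). g (x, y))"
    using g by (simp add: integrable_completion lborel_prod)
  have eq: "integral\<^sup>L lebesgue f = integral\<^sup>L (lborel \<Otimes>\<^sub>M lborel) (\<lambda>(x, y). g (x, y))"
    using integral_cong_AE[OF f_meas g_leb fg] g by (simp add: integral_completion lborel_prod)
  have slice: "integrable lebesgue h \<and> integral\<^sup>L lebesgue h = integral\<^sup>L lborel k"
    if "AE x in lebesgue. h x = k x" "integrable lborel k" for h k :: "'c::euclidean_space \<Rightarrow> real"
  proof -
    have k: "k \<in> borel_measurable lborel" "k \<in> borel_measurable lebesgue"
      using that(2) by (auto intro: measurable_completion)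
    have kh: "AE x in lebesgue. k x = h x" using that(1) by eventually_elim simp
    have h: "h \<in> borel_measurable lebesgue"
      using k(2) kh by (rule borel_measurable_AE)
    show ?thesis
      using integrable_cong_AE[OF k(2) h kh] integral_cong_AE[OF k(2) h kh] k(1) that(2)
      by (simp add: integrable_completion integral_completion)
  qed
  have fst: "AE x in lebesgue. integrable lebesgue (\<lambda>y. f (x, y)) \<and>
      (LINT y|lebesgue. f (x, y)) = (LINT y|lborel. g (x, y))"
  proof -
    have "AE x in lebesgue. integrable lborel (\<lambda>y. g (x, y))"
      using lborel_pair.AE_integrable_fst[OF int_g] by (simp add: AE_completion_iff)
    with AE_lebesgue_pair(1)[OF fg] show ?thesis
      by eventually_elim (rule slice)
  qed
  then show "AE x in lebesgue. integrable lebesgue (\<lambda>y. f (x, y))"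
    by eventually_elim simp
  have "integrable lebesgue (\<lambda>x. LINT y|lebesgue. f (x, y)) \<and>
      (LINT x|lebesgue. LINT y|lebesgue. f (x, y)) = (LINT x|lborel. LINT y|lborel. g (x, y))"
    by (rule slice[OF _ lborel_pair.integrable_fst[OF int_g]]) (use fst in \<open>eventually_elim, simp\<close>)
  then show "integrable lebesgue (\<lambda>x. LINT y|lebesgue. f (x, y))"
    and "(LINT x|lebesgue. LINT y|lebesgue. f (x, y)) = integral\<^sup>L lebesgue f"
    using lborel_pair.integral_fst[OF int_g] by (auto simp: eq)
  have snd: "AE y in lebesgue. integrable lebesgue (\<lambda>x. f (x, y)) \<and>
      (LINT x|lebesgue. f (x, y)) = (LINT x|lborel. g (x, y))"
  proof -
    have "AE y in lebesgue. integrable lborel (\<lambda>x. g (x, y))"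
      using lborel_pair.AE_integrable_snd[OF int_g] by (simp add: AE_completion_iff)
    with AE_lebesgue_pair(2)[OF fg] show ?thesis
      by eventually_elim (rule slice)
  qed
  then show "AE y in lebesgue. integrable lebesgue (\<lambda>x. f (x, y))"
    by eventually_elim simp
  have "integrable lebesgue (\<lambda>y. LINT x|lebesgue. f (x, y)) \<and>
      (LINT y|lebesgue. LINT x|lebesgue. f (x, y)) = (LINT y|lborel. LINT x|lborel. g (x, y))"
    by (rule slice[OF _ lborel_pair.integrable_snd[OF int_g]]) (use snd in \<open>eventually_elim, simp\<close>)
  then show "integrable lebesgue (\<lambda>y. LINT x|lebesgue. f (x, y))"
    and "(LINT y|lebesgue. LINT x|lebesgue. f (x, y)) = integral\<^sup>L lebesgue f"
    using lborel_pair.integral_snd[OF int_g] by (auto simp: eq)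
qed

section \<open>Integrated form of the differential inequality\<close>

lemma set_integral_box_eq_cbox:
  fixes f :: "'b::euclidean_space \<Rightarrow> real"
  shows "(LINT x:box a b|lebesgue. f x) = (LINT x:cbox a b|lebesgue. f x)"
proof -
  have "AE x in lebesgue. x \<notin> cbox a b - box a b"
    using negligible_frontier_interval[of a b] by (intro AE_not_in) (simp add: negligible_iff_null_sets)
  then have ae: "AE x in lebesgue. indicator (box a b) x *\<^sub>R f x = indicator (cbox a b) x *\<^sub>R f x"
    by eventually_elim (use box_subset_cbox in \<open>auto simp: indicator_def\<close>)
  show ?thesis
  proof (cases "set_integrable lebesgue (cbox a b) f")
    case True
    then have "set_integrable lebesgue (box a b) f"
      by (rule set_integrable_subset) (auto intro: box_subset_cbox[THEN subsetD])
    with True show ?thesis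
      unfolding set_lebesgue_integral_def set_integrable_def by (intro integral_cong_AE ae) auto
  next
    case False
    have "set_integrable lebesgue (cbox a b) f" if *: "set_integrable lebesgue (box a b) f"
    proof -
      have m: "(\<lambda>x. indicator (box a b) x *\<^sub>R f x) \<in> borel_measurable lebesgue"
        using * unfolding set_integrable_def by auto
      from integrable_cong_AE[OF m borel_measurable_AE[OF m ae] ae] * show ?thesis
        unfolding set_integrable_def by simp
    qed
    with False show ?thesis
      unfolding set_lebesgue_integral_def set_integrable_def by (metis not_integrable_integral_eq)
  qed
qed

lemma set_integrable_mult_continuous:
  fixes f g :: "'b::euclidean_space \<Rightarrow> real"
  assumes "compact K" and f: "set_integrable lebesgue K f" and g: "continuous_on UNIV g"
  shows "set_integrable lebesgue K (\<lambda>x. f x * g x)"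
proof -
  have "bounded (g ` K)"
    using compact_continuous_image[OF continuous_on_subset[OF g subset_UNIV] \<open>compact K\<close>] by (rule compact_imp_bounded)
  then obtain B where B: "\<forall>y\<in>g ` K. norm y \<le> B"
    unfolding bounded_iff by (elim exE)
  have [measurable]: "g \<in> borel_measurable lebesgue"
    by (rule measurable_completion) (use borel_measurable_continuous_onI[OF g] in simp)
  have F: "integrable lebesgue (\<lambda>x. indicator K x *\<^sub>R f x)"
    using f by (simp add: set_integrable_def)
  have "integrable lebesgue (\<lambda>x. (indicator K x *\<^sub>R f x) * g x)"
  proof (rule Bochner_Integration.integrable_bound)
    show "integrable lebesgue (\<lambda>x. B * (indicator K x *\<^sub>R f x))"
      using F by simp
    have [measurable]: "(\<lambda>x. indicator K x *\<^sub>R f x) \<in> borel_measurable lebesgue"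
      using F by auto
    show "(\<lambda>x. (indicator K x *\<^sub>R f x) * g x) \<in> borel_measurable lebesgue"
      by measurable
    show "AE x in lebesgue. norm ((indicator K x *\<^sub>R f x) * g x) \<le> norm (B * (indicator K x *\<^sub>R f x))"
    proof (rule AE_I2)
      fix x
      show "norm ((indicator K x *\<^sub>R f x) * g x) \<le> norm (B * (indicator K x *\<^sub>R f x))"
      proof (cases "x \<in> K")
        case True
        then have "\<bar>g x\<bar> \<le> \<bar>B\<bar>" using B by fastforce
        then show ?thesis
          using True by (simp add: abs_mult mult.commute[of "\<bar>B\<bar>"] mult_left_mono)
      qed simp
    qed
  qed
  then show ?thesis by (simp add: set_integrable_def mult.assoc)
qed

lemma edge_kernel_eq_0: "t \<notin> {0<..<L} \<Longrightarrow> edge_kernel L m t = 0"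
  using flat_mult_pos[of 2 m t] flat_mult_pos[of 0 m "L - t"] by (auto simp: edge_kernel_def)

lemma continuous_on_bumps [continuous_intros]:
  "continuous_on A f \<Longrightarrow> continuous_on A (\<lambda>x. time_bump c d m (f x))"
  "continuous_on A f \<Longrightarrow> continuous_on A (\<lambda>x. edge_kernel L m (f x))"
  "continuous_on A h \<Longrightarrow> continuous_on A (\<lambda>x. space_bump a b m (h x))"
  unfolding time_bump_def edge_kernel_def space_bump_def
  by (intro continuous_intros; assumption)+

text \<open>
  The difference of kernels is the derivative of \<open>time_bump c d m\<close>; its two parts are
  carried to \<open>edge_kernel_approximates_delta\<close> by the substitutions \<open>t = c + s\<close> and \<open>t = d - s\<close>.
\<close>

lemma edge_kernels_limit:
  assumes "c < d" and \<Phi>: "continuous_on {c..d} \<Phi>"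
  shows "(\<lambda>m. LINT t:{c..d}|lebesgue.
            \<Phi> t * (edge_kernel (d - c) m (t - c) - edge_kernel (d - c) m (d - t)))
         \<longlonglongrightarrow> \<Phi> c - \<Phi> d"
proof -
  define L where "L = d - c"
  have "0 < L" using \<open>c < d\<close> by (simp add: L_def)
  have \<Phi>_int: "set_integrable lebesgue {c..d} \<Phi>"
    using absolutely_integrable_continuous_real[OF \<Phi>] .
  have meas: "(\<lambda>t. indicator {c..d} t *\<^sub>R \<Phi> t) \<in> borel_measurable borel"
    by (rule borel_measurable_continuous_on_indicator[OF _ \<Phi>]) simp
  have to_lborel: "(LINT t:{c..d}|lebesgue. \<Phi> t * h t) = (LINT t|lborel. (indicator {c..d} t *\<^sub>R \<Phi> t) * h t)"
    if "continuous_on UNIV h" for h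
  proof -
    have "(\<lambda>t. (indicator {c..d} t *\<^sub>R \<Phi> t) * h t) \<in> borel_measurable lborel"
      using borel_measurable_times[OF meas borel_measurable_continuous_onI[OF that]] by simp
    from integral_completion[OF this] show ?thesis
      by (simp add: set_lebesgue_integral_def mult.assoc)
  qed
  have left: "(LINT t:{c..d}|lebesgue. \<Phi> t * edge_kernel L m (t - c))
      = (LINT s|lborel. edge_kernel L m s * \<Phi> (c + s))" for m
  proof -
    have "(LINT t:{c..d}|lebesgue. \<Phi> t * edge_kernel L m (t - c))
        = (LINT t|lborel. (indicator {c..d} t *\<^sub>R \<Phi> t) * edge_kernel L m (t - c))"
      by (rule to_lborel) (intro continuous_intros)
    also have "\<dots> = (LINT s|lborel. (indicator {c..d} (c + 1 * s) *\<^sub>R \<Phi> (c + 1 * s)) * edge_kernel L m (c + 1 * s - c))"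
      by (subst lborel_integral_real_affine[where c = 1 and t = c]) auto
    also have "\<dots> = (LINT s|lborel. edge_kernel L m s * \<Phi> (c + s))"
    proof (intro Bochner_Integration.integral_cong refl)
      fix s
      show "(indicator {c..d} (c + 1 * s) *\<^sub>R \<Phi> (c + 1 * s)) * edge_kernel L m (c + 1 * s - c) = edge_kernel L m s * \<Phi> (c + s)"
      proof (cases "s \<in> {0<..<L}")
        case False
        then have "edge_kernel L m s = 0" by (rule edge_kernel_eq_0)
        then show ?thesis by simp
      qed (simp add: L_def)
    qed
    finally show ?thesis .
  qed
  have right: "(LINT t:{c..d}|lebesgue. \<Phi> t * edge_kernel L m (d - t))
      = (LINT s|lborel. edge_kernel L m s * \<Phi> (d - s))" for m
  proof -
    have "(LINT t:{c..d}|lebesgue. \<Phi> t * edge_kernel L m (d - t))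
        = (LINT t|lborel. (indicator {c..d} t *\<^sub>R \<Phi> t) * edge_kernel L m (d - t))"
      by (rule to_lborel) (intro continuous_intros)
    also have "\<dots> = (LINT s|lborel. (indicator {c..d} (d + (-1) * s) *\<^sub>R \<Phi> (d + (-1) * s)) * edge_kernel L m (d - (d + (-1) * s)))"
      by (subst lborel_integral_real_affine[where c = "-1" and t = d]) auto
    also have "\<dots> = (LINT s|lborel. edge_kernel L m s * \<Phi> (d - s))"
    proof (intro Bochner_Integration.integral_cong refl)
      fix s
      show "(indicator {c..d} (d + (-1) * s) *\<^sub>R \<Phi> (d + (-1) * s)) * edge_kernel L m (d - (d + (-1) * s)) = edge_kernel L m s * \<Phi> (d - s)"
      proof (cases "s \<in> {0<..<L}")
        case False
        then have "edge_kernel L m s = 0" by (rule edge_kernel_eq_0)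
        then show ?thesis by simp
      qed (simp add: L_def)
    qed
    finally show ?thesis .
  qed
  have eq: "(LINT t:{c..d}|lebesgue. \<Phi> t * (edge_kernel L m (t - c) - edge_kernel L m (d - t)))
      = (LINT s|lborel. edge_kernel L m s * \<Phi> (c + s)) - (LINT s|lborel. edge_kernel L m s * \<Phi> (d - s))" for m
  proof -
    have "set_integrable lebesgue {c..d} (\<lambda>t. \<Phi> t * edge_kernel L m (t - c))"
      "set_integrable lebesgue {c..d} (\<lambda>t. \<Phi> t * edge_kernel L m (d - t))"
      by (intro set_integrable_mult_continuous \<Phi>_int continuous_intros compact_Icc)+
    from set_integral_diff(2)[OF this] show ?thesis
      by (simp add: left right right_diff_distrib)
  qed
  have "(\<lambda>m. LINT s|lborel. edge_kernel L m s * \<Phi> (c + s)) \<longlonglongrightarrow> \<Phi> (c + 0)"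
    by (rule edge_kernel_approximates_delta[OF \<open>0 < L\<close>])
       (rule continuous_on_compose2[OF \<Phi>], auto simp: L_def intro!: continuous_intros)
  moreover have "(\<lambda>m. LINT s|lborel. edge_kernel L m s * \<Phi> (d - s)) \<longlonglongrightarrow> \<Phi> (d - 0)"
    by (rule edge_kernel_approximates_delta[OF \<open>0 < L\<close>])
       (rule continuous_on_compose2[OF \<Phi>], auto simp: L_def intro!: continuous_intros)
  ultimately have "(\<lambda>m. (LINT s|lborel. edge_kernel L m s * \<Phi> (c + s)) - (LINT s|lborel. edge_kernel L m s * \<Phi> (d - s)))
      \<longlonglongrightarrow> \<Phi> (c + 0) - \<Phi> (d - 0)"
    by (rule tendsto_diff)
  then show ?thesis
    unfolding L_def[symmetric] eq by simp
qed

text \<open>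
  The factor \<open>exp s\<close> contributes the first summand. In the weak inequality it cancels the
  term \<open>- f\<close> on the right-hand side.
\<close>

lemma deriv_bump:
  "deriv (\<lambda>s. space_bump a b n x * (exp s * time_bump c d m s)) t
   = space_bump a b n x * (exp t * time_bump c d m t
       + exp t * (edge_kernel (d - c) m (t - c) - edge_kernel (d - c) m (d - t)))"
  by (rule DERIV_imp_deriv)
     (auto intro!: derivative_eq_intros DERIV_time_bump simp: algebra_simps)

lemma edge_kernels_eq_0:
  "t \<notin> {c..d} \<Longrightarrow> edge_kernel (d - c) m (t - c) = 0"
  "t \<notin> {c..d} \<Longrightarrow> edge_kernel (d - c) m (d - t) = 0"
  by (rule edge_kernel_eq_0, auto)+

lemma space_bump_eq_0: "x \<notin> cbox a b \<Longrightarrow> space_bump a b n x = 0"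
  using space_bump_bounds[of a b n x] box_subset_cbox[of a b] by (cases "x \<in> box a b") auto

lemma time_bump_eq_0: "t \<notin> {c..d} \<Longrightarrow> time_bump c d m t = 0"
  using time_bump_bounds[of c d m t] by (cases "t \<in> {c<..<d}") auto

lemma set_integral_dominated_by_1:
  fixes f :: "'b \<Rightarrow> real"
  assumes f: "set_integrable M K f"
    and g: "\<And>n. g n \<in> borel_measurable M" "g' \<in> borel_measurable M"
    and bd: "\<And>n x. \<bar>g n x\<bar> \<le> 1" and lim: "\<And>x. (\<lambda>n. g n x) \<longlonglongrightarrow> g' x"
  shows "(\<lambda>n. LINT x:K|M. f x * g n x) \<longlonglongrightarrow> (LINT x:K|M. f x * (g' x :: real))"
proof -
  have F: "integrable M (\<lambda>x. indicator K x *\<^sub>R f x)"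
    using f by (simp add: set_integrable_def)
  then have [measurable]: "(\<lambda>x. indicator K x *\<^sub>R f x) \<in> borel_measurable M"
    by (rule borel_measurable_integrable)
  note [measurable] = g
  have "(\<lambda>n. LINT x|M. (indicator K x *\<^sub>R f x) * g n x) \<longlonglongrightarrow> (LINT x|M. (indicator K x *\<^sub>R f x) * g' x)"
  proof (rule integral_dominated_convergence[where w = "\<lambda>x. norm (indicator K x *\<^sub>R f x)"])
    show "integrable M (\<lambda>x. norm (indicator K x *\<^sub>R f x))"
      using F by (rule integrable_norm)
    show "AE x in M. (\<lambda>n. (indicator K x *\<^sub>R f x) * g n x) \<longlonglongrightarrow> (indicator K x *\<^sub>R f x) * g' x"
      by (intro AE_I2 tendsto_intros lim)
    show "AE x in M. norm ((indicator K x *\<^sub>R f x) * g n x) \<le> norm (indicator K x *\<^sub>R f x)" for n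
      unfolding norm_mult by (intro AE_I2 mult_right_le_one_le) (use bd in auto)
  qed measurable
  then show ?thesis by (simp add: set_lebesgue_integral_def mult.assoc)
qed

lemma borel_lebesgue: "f \<in> borel_measurable borel \<Longrightarrow> f \<in> borel_measurable lebesgue"
  by (rule measurable_completion) simp

text \<open>
  The test function is \<open>\<eta>(x) e\<^sup>t \<theta>(t)\<close>, with \<open>\<eta>\<close> approximating the box and \<open>\<theta>\<close>
  the time interval. First \<open>\<eta>\<close> passes to its limit, which only needs dominated convergence. Then
  Fubini's theorem exhibits the integral against \<open>\<theta>'\<close> as one of the function \<open>\<Phi>\<close> of time
  alone, and continuity of \<open>\<Phi>\<close> gives its boundary values as \<open>\<theta>\<close> passes to its limit.
\<close>

lemma supersolution_box_ineq:
  fixes f :: "'a::euclidean_space \<Rightarrow> real \<Rightarrow> real"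
  assumes super: "supersolution J f"
    and loc: "L1loc (UNIV \<times> {0<..}) (\<lambda>(x, t). f x t)"
    and cont: "\<And>a b. continuous_on {0<..} (\<lambda>t. LINT x:cbox a b|lebesgue. f x t)"
    and "0 < c" "c < d"
  shows "(LINT p:cbox a b \<times> {c..d}|lebesgue. conv J (\<lambda>y. f y (snd p)) (fst p) * exp (snd p))
         \<le> exp d * (LINT x:cbox a b|lebesgue. f x d) - exp c * (LINT x:cbox a b|lebesgue. f x c)"
proof -
  define q where "q = (\<lambda>(x, t). conv J (\<lambda>y. f y t) x)"
  define F where "F = (\<lambda>(x, t). f x t)"
  let ?K = "cbox a b \<times> {c..d}"
  define \<Phi> where "\<Phi> t = exp t * (LINT x:cbox a b|lebesgue. f x t)" for t
  define \<kappa> where "\<kappa> m t = edge_kernel (d - c) m (t - c) - edge_kernel (d - c) m (d - t)" for m t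
  have K: "compact ?K" "?K \<subseteq> UNIV \<times> {0<..}"
    using \<open>0 < c\<close> by (auto intro: compact_Times)
  have q: "set_integrable lebesgue ?K q"
    using super K unfolding supersolution_def conv_L1loc_def L1loc_def q_def by blast
  have F: "set_integrable lebesgue ?K F"
    using loc K unfolding L1loc_def F_def by blast
  have test: "(LINT p:?K|lebesgue. (q p * (exp (snd p) * time_bump c d m (snd p))) * space_bump a b n (fst p))
      \<le> - (LINT p:?K|lebesgue. (F p * (exp (snd p) * \<kappa> m (snd p))) * space_bump a b n (fst p))" for n m
  proof -
    let ?\<phi> = "\<lambda>(x, t). space_bump a b n x * (exp t * time_bump c d m t)"
    let ?w = "\<lambda>p. (exp (snd p) * time_bump c d m (snd p)) * space_bump a b n (fst p)"
    let ?k = "\<lambda>p. (exp (snd p) * \<kappa> m (snd p)) * space_bump a b n (fst p)"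
    have contw: "continuous_on UNIV ?w" and contk: "continuous_on UNIV ?k"
      unfolding \<kappa>_def by (intro continuous_intros)+
    note i1 = set_integrable_mult_continuous[OF K(1) q contw]
      and i2 = set_integrable_mult_continuous[OF K(1) F contw]
      and i3 = set_integrable_mult_continuous[OF K(1) F contk]
    have "\<forall>p. 0 \<le> ?\<phi> p"
      by (auto simp: space_bump_bounds(1) time_bump_bounds(1))
    then have "dt_pairing f ?\<phi> \<ge> (LINT (x, t)|lebesgue. (conv J (\<lambda>y. f y t) x - f x t) * ?\<phi> (x, t))"
      using super test_fun_bump[OF \<open>0 < c\<close>, of a b n d m] unfolding supersolution_def by blast
    also have "dt_pairing f ?\<phi> = - (LINT p:?K|lebesgue. F p * ?w p + F p * ?k p)"
      unfolding dt_pairing_def set_lebesgue_integral_def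
    proof (intro arg_cong[where f = uminus] Bochner_Integration.integral_cong refl)
      fix p :: "'a \<times> real"
      obtain x t where p: "p = (x, t)" by fastforce
      have "f x t * deriv (\<lambda>s. ?\<phi> (x, s)) t = indicator ?K (x, t) *\<^sub>R (F (x, t) * ?w (x, t) + F (x, t) * ?k (x, t))"
      proof (cases "(x, t) \<in> ?K")
        case True
        then show ?thesis
          unfolding prod.case deriv_bump by (simp add: F_def \<kappa>_def algebra_simps)
      next
        case False
        then have "space_bump a b n x = 0 \<or> time_bump c d m t = 0 \<and> \<kappa> m t = 0"
          using space_bump_eq_0[of x a b n] time_bump_eq_0[of t c d m] edge_kernels_eq_0[of t c d m] by (auto simp: \<kappa>_def)
        with False show ?thesis
          unfolding prod.case deriv_bump by (auto simp: \<kappa>_def)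
      qed
      then show "(case p of (x, t) \<Rightarrow> f x t * deriv (\<lambda>s. ?\<phi> (x, s)) t)
          = indicator ?K p *\<^sub>R (F p * ?w p + F p * ?k p)"
        unfolding p by simp
    qed
    also have "\<dots> = - (LINT p:?K|lebesgue. F p * ?w p) - (LINT p:?K|lebesgue. F p * ?k p)"
      by (subst set_integral_add(2)[OF i2 i3]) simp
    also have "(LINT (x, t)|lebesgue. (conv J (\<lambda>y. f y t) x - f x t) * ?\<phi> (x, t))
        = (LINT p:?K|lebesgue. q p * ?w p - F p * ?w p)"
      unfolding set_lebesgue_integral_def
    proof (intro Bochner_Integration.integral_cong refl)
      fix p :: "'a \<times> real"
      obtain x t where p: "p = (x, t)" by fastforce
      have "(conv J (\<lambda>y. f y t) x - f x t) * ?\<phi> (x, t) = indicator ?K (x, t) *\<^sub>R (q (x, t) * ?w (x, t) - F (x, t) * ?w (x, t))"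
      proof (cases "(x, t) \<in> ?K")
        case True
        then show ?thesis by (simp add: F_def q_def algebra_simps)
      next
        case False
        then have "space_bump a b n x = 0 \<or> time_bump c d m t = 0"
          using space_bump_eq_0[of x a b n] time_bump_eq_0[of t c d m] by auto
        with False show ?thesis by auto
      qed
      then show "(case p of (x, t) \<Rightarrow> (conv J (\<lambda>y. f y t) x - f x t) * ?\<phi> (x, t))
          = indicator ?K p *\<^sub>R (q p * ?w p - F p * ?w p)"
        unfolding p by simp
    qed
    also have "\<dots> = (LINT p:?K|lebesgue. q p * ?w p) - (LINT p:?K|lebesgue. F p * ?w p)"
      by (rule set_integral_diff(2)[OF i1 i2])
    finally show ?thesis by (simp add: mult.assoc)
  qed
  have space_meas: "(\<lambda>p. space_bump a b n (fst p)) \<in> borel_measurable (lebesgue :: ('a \<times> real) measure)" for n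
    by (intro borel_lebesgue borel_measurable_continuous_onI continuous_intros)
  have box_meas: "(\<lambda>p. indicator (box a b) (fst p) :: real) \<in> borel_measurable (lebesgue :: ('a \<times> real) measure)"
  proof -
    have "open (fst -` box a b :: ('a \<times> real) set)" by (intro open_vimage_fst open_box)
    then have "(indicator (fst -` box a b) :: 'a \<times> real \<Rightarrow> real) \<in> borel_measurable borel"
      by (intro borel_measurable_indicator) simp
    moreover have "(indicator (fst -` box a b) :: 'a \<times> real \<Rightarrow> real) = (\<lambda>p. indicator (box a b) (fst p))"
      by (auto simp: indicator_def)
    ultimately show ?thesis
      by (intro borel_lebesgue) simp
  qed
  have space_lim: "(\<lambda>n. LINT p:?K|lebesgue. g p * space_bump a b n (fst p))
      \<longlonglongrightarrow> (LINT p:?K|lebesgue. g p * indicator (box a b) (fst p))"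
    if "set_integrable lebesgue ?K g" for g
  proof (rule set_integral_dominated_by_1[OF that space_meas box_meas])
    show "\<bar>space_bump a b n (fst p)\<bar> \<le> 1" for n and p :: "'a \<times> real"
      using space_bump_bounds[of a b n "fst p"] by (cases "fst p \<in> box a b") auto
  qed (rule space_bump_tendsto)
  have F\<kappa>: "set_integrable lebesgue ?K (\<lambda>p. F p * (exp (snd p) * \<kappa> m (snd p)))" for m
    unfolding \<kappa>_def by (intro set_integrable_mult_continuous K F continuous_intros)
  have step: "(LINT p:?K|lebesgue. (q p * (exp (snd p) * time_bump c d m (snd p))) * indicator (box a b) (fst p))
      \<le> - (LINT p:?K|lebesgue. (F p * (exp (snd p) * \<kappa> m (snd p))) * indicator (box a b) (fst p))" for m
  proof (rule LIMSEQ_le)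
    show "(\<lambda>n. LINT p:?K|lebesgue. (q p * (exp (snd p) * time_bump c d m (snd p))) * space_bump a b n (fst p))
       \<longlonglongrightarrow> (LINT p:?K|lebesgue. (q p * (exp (snd p) * time_bump c d m (snd p))) * indicator (box a b) (fst p))"
      by (intro space_lim set_integrable_mult_continuous K q continuous_intros)
    show "(\<lambda>n. - (LINT p:?K|lebesgue. (F p * (exp (snd p) * \<kappa> m (snd p))) * space_bump a b n (fst p)))
       \<longlonglongrightarrow> - (LINT p:?K|lebesgue. (F p * (exp (snd p) * \<kappa> m (snd p))) * indicator (box a b) (fst p))"
      by (intro tendsto_minus space_lim F\<kappa>)
  qed (use test in blast)
  have Fub: "(LINT p:?K|lebesgue. (F p * (exp (snd p) * \<kappa> m (snd p))) * indicator (box a b) (fst p))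
      = (LINT t:{c..d}|lebesgue. \<Phi> t * \<kappa> m t)" for m
  proof -
    let ?G = "\<lambda>p. indicator ?K p *\<^sub>R ((F p * (exp (snd p) * \<kappa> m (snd p))) * indicator (box a b) (fst p))"
    have "integrable lebesgue ?G"
    proof (rule Bochner_Integration.integrable_bound)
      show I: "integrable lebesgue (\<lambda>p. indicator ?K p *\<^sub>R (F p * (exp (snd p) * \<kappa> m (snd p))))"
        using F\<kappa> by (simp add: set_integrable_def)
      have "(\<lambda>p. (indicator ?K p *\<^sub>R (F p * (exp (snd p) * \<kappa> m (snd p)))) * indicator (box a b) (fst p)) \<in> borel_measurable lebesgue"
        by (intro borel_measurable_times box_meas borel_measurable_integrable[OF I])
      then show "?G \<in> borel_measurable lebesgue" by (simp add: mult.assoc)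
      show "AE p in lebesgue. norm (?G p) \<le> norm (indicator ?K p *\<^sub>R (F p * (exp (snd p) * \<kappa> m (snd p))))"
        by (intro AE_I2) (auto simp: indicator_def)
    qed
    from Fubini_lebesgue(6)[OF this]
    have "(LINT p:?K|lebesgue. (F p * (exp (snd p) * \<kappa> m (snd p))) * indicator (box a b) (fst p))
        = (LINT t|lebesgue. LINT x|lebesgue. ?G (x, t))"
      unfolding set_lebesgue_integral_def by (rule sym)
    also have "\<dots> = (LINT t|lebesgue. indicator {c..d} t *\<^sub>R (\<Phi> t * \<kappa> m t))"
    proof (intro Bochner_Integration.integral_cong refl)
      fix t
      have "(LINT x|lebesgue. ?G (x, t))
          = (LINT x|lebesgue. (indicator {c..d} t * exp t * \<kappa> m t) * (indicator (box a b) x *\<^sub>R f x t))"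
        using box_subset_cbox[of a b]
        by (intro Bochner_Integration.integral_cong refl) (auto simp: indicator_def F_def)
      also have "\<dots> = (indicator {c..d} t * exp t * \<kappa> m t) * (LINT x:box a b|lebesgue. f x t)"
        unfolding set_lebesgue_integral_def by (rule integral_mult_right_zero)
      finally show "(LINT x|lebesgue. ?G (x, t)) = indicator {c..d} t *\<^sub>R (\<Phi> t * \<kappa> m t)"
        by (simp add: \<Phi>_def set_integral_box_eq_cbox)
    qed
    finally show ?thesis by (simp add: set_lebesgue_integral_def)
  qed
  have "(\<lambda>m. LINT t:{c..d}|lebesgue. \<Phi> t * \<kappa> m t) \<longlonglongrightarrow> \<Phi> c - \<Phi> d"
    unfolding \<kappa>_def
  proof (rule edge_kernels_limit[OF \<open>c < d\<close>])
    show "continuous_on {c..d} \<Phi>"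
      unfolding \<Phi>_def using \<open>0 < c\<close>
      by (intro continuous_intros continuous_on_subset[OF cont]) auto
  qed
  then have right: "(\<lambda>m. - (LINT p:?K|lebesgue. (F p * (exp (snd p) * \<kappa> m (snd p))) * indicator (box a b) (fst p)))
      \<longlonglongrightarrow> - (\<Phi> c - \<Phi> d)"
    unfolding Fub by (rule tendsto_minus)
  have left: "(\<lambda>m. LINT p:?K|lebesgue. (q p * exp (snd p)) * (time_bump c d m (snd p) * indicator (box a b) (fst p)))
      \<longlonglongrightarrow> (LINT p:?K|lebesgue. (q p * exp (snd p)) * indicator (box (a, c) (b, d)) p)"
  proof (rule set_integral_dominated_by_1)
    show "set_integrable lebesgue ?K (\<lambda>p. q p * exp (snd p))"
      by (intro set_integrable_mult_continuous K q continuous_intros)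
    show "(\<lambda>p. time_bump c d m (snd p) * indicator (box a b) (fst p)) \<in> borel_measurable (lebesgue :: ('a \<times> real) measure)" for m
      by (intro borel_measurable_times box_meas borel_lebesgue borel_measurable_continuous_onI continuous_intros)
    show "(indicator (box (a, c) (b, d)) :: _ \<Rightarrow> real) \<in> borel_measurable lebesgue"
      by (intro borel_lebesgue borel_measurable_indicator) simp
    show "\<bar>time_bump c d m (snd p) * indicator (box a b) (fst p)\<bar> \<le> 1" for m and p :: "'a \<times> real"
      using time_bump_bounds[of c d m "snd p"] by (cases "snd p \<in> {c<..<d}"; cases "fst p \<in> box a b") auto
    show "(\<lambda>m. time_bump c d m (snd p) * indicator (box a b) (fst p)) \<longlonglongrightarrow> indicator (box (a, c) (b, d)) p" for p :: "'a \<times> real"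
    proof -
      have "(indicator (box (a, c) (b, d)) p :: real) = indicator {c<..<d} (snd p) * indicator (box a b) (fst p)"
        by (cases p) (auto simp: indicator_def mem_box Basis_prod_def)
      then show ?thesis
        by (auto intro!: tendsto_mult time_bump_tendsto)
    qed
  qed
  have "(LINT p:?K|lebesgue. (q p * exp (snd p)) * indicator (box (a, c) (b, d)) p) \<le> - (\<Phi> c - \<Phi> d)"
    by (rule LIMSEQ_le[OF left right]) (use step in \<open>auto simp: mult.assoc\<close>)
  also have "(LINT p:?K|lebesgue. (q p * exp (snd p)) * indicator (box (a, c) (b, d)) p)
      = (LINT p:box (a, c) (b, d)|lebesgue. q p * exp (snd p))"
    unfolding set_lebesgue_integral_def
    using box_subset_cbox[of "(a, c)" "(b, d)"]
    by (intro Bochner_Integration.integral_cong refl) (auto simp: indicator_def cbox_Pair_eq)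
  also have "\<dots> = (LINT p:?K|lebesgue. q p * exp (snd p))"
    by (simp add: set_integral_box_eq_cbox cbox_Pair_eq)
  finally show ?thesis
    by (simp add: \<Phi>_def q_def case_prod_beta)
qed

text \<open>
  The difference of the two sides is a function of \<open>x\<close> whose integrals over boxes are
  nonnegative by \<open>supersolution_box_ineq\<close> and Fubini's theorem.
\<close>

lemma supersolution_duhamel:
  fixes f :: "'a::euclidean_space \<Rightarrow> real \<Rightarrow> real"
  assumes super: "supersolution J f"
    and loc: "L1loc (UNIV \<times> {0<..}) (\<lambda>(x, t). f x t)"
    and slices: "\<And>t a b. 0 < t \<Longrightarrow> set_integrable lebesgue (cbox a b) (\<lambda>x. f x t)"
    and cont: "\<And>a b. continuous_on {0<..} (\<lambda>t. LINT x:cbox a b|lebesgue. f x t)"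
    and "0 < c" "c < d"
  shows "AE x in lebesgue.
    set_integrable lebesgue {c..d} (\<lambda>s. conv J (\<lambda>y. f y s) x * exp s) \<and>
    (LINT s:{c..d}|lebesgue. conv J (\<lambda>y. f y s) x * exp s) \<le> exp d * f x d - exp c * f x c"
proof -
  define Q where "Q = (\<lambda>p. conv J (\<lambda>y. f y (snd p)) (fst p) * exp (snd p))"
  define I where "I x = (LINT s:{c..d}|lebesgue. Q (x, s))" for x
  have G: "integrable lebesgue (\<lambda>p. indicator (cbox a b \<times> {c..d}) p *\<^sub>R Q p)" for a b
  proof -
    have "compact (cbox a b \<times> {c..d})" "cbox a b \<times> {c..d} \<subseteq> UNIV \<times> {0<..}"
      using \<open>0 < c\<close> by (auto intro: compact_Times)
    moreover from this have "set_integrable lebesgue (cbox a b \<times> {c..d}) (\<lambda>(x, t). conv J (\<lambda>y. f y t) x)"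
      using super unfolding supersolution_def conv_L1loc_def L1loc_def by blast
    ultimately have "set_integrable lebesgue (cbox a b \<times> {c..d}) (\<lambda>p. (case p of (x, t) \<Rightarrow> conv J (\<lambda>y. f y t) x) * exp (snd p))"
      by (intro set_integrable_mult_continuous continuous_intros)
    then show ?thesis
      by (simp add: set_integrable_def Q_def case_prod_beta)
  qed
  have ind: "indicator (cbox a b \<times> {c..d}) (x, s) *\<^sub>R Q (x, s) = indicator (cbox a b) x *\<^sub>R (indicator {c..d} s *\<^sub>R Q (x, s))" for a b x s
    by (auto simp: indicator_def)
  have inner: "(LINT s|lebesgue. indicator (cbox a b \<times> {c..d}) (x, s) *\<^sub>R Q (x, s)) = indicator (cbox a b) x *\<^sub>R I x" for a b x
    unfolding ind I_def set_lebesgue_integral_def by (rule integral_scaleR_right)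
  have 1: "AE x in lebesgue. set_integrable lebesgue {c..d} (\<lambda>s. Q (x, s))"
  proof (rule AE_if_AE_on_boxes)
    fix a b
    show "AE x in lebesgue. x \<in> box a b \<longrightarrow> set_integrable lebesgue {c..d} (\<lambda>s. Q (x, s))"
      using Fubini_lebesgue(1)[OF G[of a b]]
      unfolding ind
      by eventually_elim (use box_subset_cbox in \<open>auto simp: set_integrable_def indicator_def\<close>)
  qed
  have I_int: "set_integrable lebesgue (cbox a b) I" for a b
    using Fubini_lebesgue(2)[OF G[of a b]] unfolding inner set_integrable_def .
  have I_eq: "(LINT x:cbox a b|lebesgue. I x) = (LINT p:cbox a b \<times> {c..d}|lebesgue. Q p)" for a b
    using Fubini_lebesgue(3)[OF G[of a b]] unfolding inner set_lebesgue_integral_def .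
  have f_int: "set_integrable lebesgue (cbox a b) (\<lambda>x. exp t * f x t)" if "0 < t" for a b t
    using slices[OF that] by (intro set_integrable_mult_right)
  have "0 < d" using \<open>0 < c\<close> \<open>c < d\<close> by simp
  have diff: "set_integrable lebesgue (cbox a b) (\<lambda>x. exp d * f x d - exp c * f x c)" for a b
    using f_int[OF \<open>0 < d\<close>] f_int[OF \<open>0 < c\<close>] by (rule set_integral_diff(1))
  have "AE x in lebesgue. 0 \<le> exp d * f x d - exp c * f x c - I x"
  proof (rule AE_nonneg_if_cbox_integrals_nonneg)
    fix a b
    show "set_integrable lebesgue (cbox a b) (\<lambda>x. exp d * f x d - exp c * f x c - I x)"
      by (rule set_integral_diff(1)[OF diff I_int])
    have "(LINT x:cbox a b|lebesgue. exp d * f x d - exp c * f x c - I x)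
        = exp d * (LINT x:cbox a b|lebesgue. f x d) - exp c * (LINT x:cbox a b|lebesgue. f x c)
          - (LINT p:cbox a b \<times> {c..d}|lebesgue. Q p)"
      by (simp only: set_integral_diff(2)[OF diff I_int] set_integral_diff(2)[OF f_int[OF \<open>0 < d\<close>] f_int[OF \<open>0 < c\<close>]]
          I_eq set_integral_mult_right)
    also have "0 \<le> \<dots>"
      using supersolution_box_ineq[OF super loc cont \<open>0 < c\<close> \<open>c < d\<close>, of a b] by (simp add: Q_def)
    finally show "0 \<le> (LINT x:cbox a b|lebesgue. exp d * f x d - exp c * f x c - I x)" .
  qed
  with 1 show ?thesis
    by eventually_elim (simp add: I_def Q_def)
qed

section \<open>Regularity of the supersolution and of strong solutions\<close>

lemma set_integrable_compact_continuous:
  fixes f :: "'b::euclidean_space \<Rightarrow> real"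
  assumes "compact K" "continuous_on K f"
  shows "set_integrable lebesgue K f"
  using borel_integrable_compact[OF assms] unfolding set_integrable_def
  by (subst integrable_completion) (auto dest: borel_measurable_integrable)

lemma continuous_L1loc:
  fixes f :: "'a::euclidean_space \<Rightarrow> real \<Rightarrow> real"
  assumes f: "continuous_on (UNIV \<times> {0..}) (\<lambda>(x, t). f x t)"
  shows "L1loc (UNIV \<times> {0<..}) (\<lambda>(x, t). f x t)"
    and "0 \<le> t \<Longrightarrow> set_integrable lebesgue (cbox a b) (\<lambda>x. f x t)"
    and "continuous_on {0..} (\<lambda>t. LINT x:cbox a b|lebesgue. f x t)"
proof -
  show "L1loc (UNIV \<times> {0<..}) (\<lambda>(x, t). f x t)"
    unfolding L1loc_def
    by (intro allI impI set_integrable_compact_continuous continuous_on_subset[OF f]) auto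
  have slice: "continuous_on (cbox a b) (\<lambda>x. f x t)" if "0 \<le> t" for t
  proof -
    have "continuous_on (cbox a b) (\<lambda>x. case (x, t) of (x, t) \<Rightarrow> f x t)"
      by (rule continuous_on_compose2[OF f]) (use that in \<open>auto intro!: continuous_intros\<close>)
    then show ?thesis by simp
  qed
  then show int: "set_integrable lebesgue (cbox a b) (\<lambda>x. f x t)" if "0 \<le> t" for t
    using that by (intro set_integrable_compact_continuous) auto
  have "continuous_on ({0..} \<times> cbox a b) (\<lambda>(t, x). f x t)"
  proof -
    have "continuous_on ({0..} \<times> cbox a b) (\<lambda>p. case (snd p, fst p) of (x, t) \<Rightarrow> f x t)"
      by (rule continuous_on_compose2[OF f]) (auto intro!: continuous_intros)
    then show ?thesis by (simp add: case_prod_beta)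
  qed
  then have "continuous_on {0..} (\<lambda>t. integral (cbox a b) (\<lambda>x. f x t))"
    by (rule integral_continuous_on_param)
  then show "continuous_on {0..} (\<lambda>t. LINT x:cbox a b|lebesgue. f x t)"
    by (rule continuous_on_cong[THEN iffD1, rotated -1])
       (use set_lebesgue_integral_eq_integral(2)[OF int] in auto)
qed

lemma cont_in_time_slice:
  assumes "cont_in_time_L1loc u" "compact K" "0 \<le> t"
  shows "set_integrable lebesgue K (\<lambda>x. u x t)"
  using assms unfolding cont_in_time_L1loc_def L1loc_def by blast

lemma cont_in_time_integral:
  fixes u :: "'a::euclidean_space \<Rightarrow> real \<Rightarrow> real"
  assumes u: "cont_in_time_L1loc u" and K: "compact K"
  shows "continuous_on {0..} (\<lambda>t. LINT x:K|lebesgue. u x t)"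
  unfolding continuous_on_def
proof
  fix s :: real assume "s \<in> {0..}"
  then have s: "0 \<le> s" by simp
  show "((\<lambda>t. LINT x:K|lebesgue. u x t) \<longlongrightarrow> (LINT x:K|lebesgue. u x s)) (at s within {0..})"
  proof (rule Lim_transform2[OF tendsto_const], rule Lim_null_comparison)
    show "((\<lambda>t. LINT x:K|lebesgue. \<bar>u x t - u x s\<bar>) \<longlongrightarrow> 0) (at s within {0..})"
      using u K s unfolding cont_in_time_L1loc_def by blast
    show "\<forall>\<^sub>F t in at s within {0..}. norm ((LINT x:K|lebesgue. u x s) - (LINT x:K|lebesgue. u x t))
        \<le> (LINT x:K|lebesgue. \<bar>u x t - u x s\<bar>)"
      unfolding eventually_at
    proof (intro exI[of _ 1] conjI ballI impI)
      fix t :: real assume t: "t \<in> {0..}"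
      have "(LINT x:K|lebesgue. u x t) - (LINT x:K|lebesgue. u x s) = (LINT x:K|lebesgue. u x t - u x s)"
        using t s cont_in_time_slice[OF u K] by (intro set_integral_diff(2)[symmetric]) auto
      also have "norm \<dots> \<le> (LINT x:K|lebesgue. norm (u x t - u x s))"
        using t s cont_in_time_slice[OF u K] by (intro set_integral_norm_bound set_integral_diff(1)) auto
      finally show "norm ((LINT x:K|lebesgue. u x s) - (LINT x:K|lebesgue. u x t))
        \<le> (LINT x:K|lebesgue. \<bar>u x t - u x s\<bar>)"
        by (simp add: norm_minus_commute)
    qed simp
  qed
qed

lemma test_fun_mult_integrable:
  fixes h :: "'a::euclidean_space \<times> real \<Rightarrow> real"
  assumes \<phi>: "test_fun \<phi>" and h: "L1loc (UNIV \<times> {0<..}) h"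
  shows "integrable lebesgue (\<lambda>p. h p * \<phi> p)"
proof -
  let ?K = "closure {p. \<phi> p \<noteq> 0}"
  have "continuous_on UNIV \<phi>"
    using \<phi> unfolding test_fun_def by (metis Ck.simps(1))
  then have "set_integrable lebesgue ?K (\<lambda>p. h p * \<phi> p)"
    using \<phi> h unfolding test_fun_def L1loc_def by (intro set_integrable_mult_continuous) auto
  moreover have "(\<lambda>p. indicator ?K p *\<^sub>R (h p * \<phi> p)) = (\<lambda>p. h p * \<phi> p)"
    using closure_subset[of "{p. \<phi> p \<noteq> 0}"] by (auto simp: fun_eq_iff indicator_def)
  ultimately show ?thesis by (simp only: set_integrable_def)
qed

text \<open>
  The equation \<open>u\<^sub>t = J \<ast> u - u\<close> is known almost everywhere for positive times only, where the
  test function is supported.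
\<close>

lemma strong_solution_dt_pairing:
  fixes u :: "'a::euclidean_space \<Rightarrow> real \<Rightarrow> real"
  assumes u: "strong_solution J u0 u" and \<phi>: "test_fun \<phi>"
  shows "dt_pairing u \<phi> = (LINT (x, t)|lebesgue. (conv J (\<lambda>y. u y t) x - u x t) * \<phi> (x, t))"
proof -
  obtain g where g: "L1loc (UNIV \<times> {0<..}) (\<lambda>(x, t). g x t)" "has_dt u g"
    and ae: "AE (x, t) in lebesgue. 0 < t \<longrightarrow> g x t = conv J (\<lambda>y. u y t) x - u x t"
    using u unfolding strong_solution_def by blast
  have "integrable lebesgue (\<lambda>p. (case p of (x, t) \<Rightarrow> conv J (\<lambda>y. u y t) x) * \<phi> p)"
    "integrable lebesgue (\<lambda>p. (case p of (x, t) \<Rightarrow> u x t) * \<phi> p)"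
    using u test_fun_mult_integrable[OF \<phi>] unfolding strong_solution_def conv_L1loc_def by blast+
  from Bochner_Integration.integrable_diff[OF this]
  have int: "integrable lebesgue (\<lambda>(x, t). (conv J (\<lambda>y. u y t) x - u x t) * \<phi> (x, t))"
    by (rule back_subst[where P = "integrable lebesgue"]) (auto simp: fun_eq_iff left_diff_distrib)
  have int_g: "integrable lebesgue (\<lambda>(x, t). g x t * \<phi> (x, t))"
    using test_fun_mult_integrable[OF \<phi> g(1)]
    by (rule back_subst[where P = "integrable lebesgue"]) (auto simp: fun_eq_iff)
  have zero: "\<phi> (x, t) = 0" if "\<not> 0 < t" for x t
    using \<phi> that closure_subset[of "{p. \<phi> p \<noteq> 0}"] unfolding test_fun_def by fastforce
  have "dt_pairing u \<phi> = (LINT (x, t)|lebesgue. g x t * \<phi> (x, t))"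
    using g(2) \<phi> unfolding has_dt_def by blast
  also have "\<dots> = (LINT (x, t)|lebesgue. (conv J (\<lambda>y. u y t) x - u x t) * \<phi> (x, t))"
  proof (rule integral_cong_AE)
    show "AE p in lebesgue. (case p of (x, t) \<Rightarrow> g x t * \<phi> (x, t))
        = (case p of (x, t) \<Rightarrow> (conv J (\<lambda>y. u y t) x - u x t) * \<phi> (x, t))"
      using ae
    proof eventually_elim
      fix p :: "'a \<times> real"
      assume *: "case p of (x, t) \<Rightarrow> 0 < t \<longrightarrow> g x t = conv J (\<lambda>y. u y t) x - u x t"
      obtain x t where p: "p = (x, t)" by fastforce
      show "(case p of (x, t) \<Rightarrow> g x t * \<phi> (x, t))
        = (case p of (x, t) \<Rightarrow> (conv J (\<lambda>y. u y t) x - u x t) * \<phi> (x, t))"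
        using * zero[of t x] unfolding p by (cases "0 < t") auto
    qed
  qed (use int int_g in auto)
  finally show ?thesis .
qed

lemma conv_minus: "conv J (\<lambda>y. - f y) x = - conv J f x"
  unfolding conv_def by simp

lemma strong_solution_supersolution:
  fixes u :: "'a::euclidean_space \<Rightarrow> real \<Rightarrow> real"
  assumes u: "strong_solution J u0 u"
  shows "supersolution J u" and "supersolution J (\<lambda>x t. - u x t)"
proof -
  have conv: "conv_L1loc J u" using u unfolding strong_solution_def by blast
  then show "supersolution J u"
    using strong_solution_dt_pairing[OF u] unfolding supersolution_def by simp
  have "L1loc (UNIV \<times> {0<..}) (\<lambda>(x, t). - conv J (\<lambda>y. u y t) x)"
    using conv unfolding conv_L1loc_def L1loc_def
    by (auto simp: case_prod_beta set_integrable_def)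
  then have conv': "conv_L1loc J (\<lambda>x t. - u x t)"
    using conv unfolding conv_L1loc_def by (simp add: conv_minus)
  have "dt_pairing (\<lambda>x t. - u x t) \<phi>
      = (LINT (x, t)|lebesgue. (conv J (\<lambda>y. - u y t) x - - u x t) * \<phi> (x, t))"
    if \<phi>: "test_fun \<phi>" for \<phi>
  proof -
    have "dt_pairing (\<lambda>x t. - u x t) \<phi> = - dt_pairing u \<phi>"
    proof -
      have "(LINT (x, t)|lebesgue. - u x t * deriv (\<lambda>s. \<phi> (x, s)) t)
          = (LINT p|lebesgue. - (case p of (x, t) \<Rightarrow> u x t * deriv (\<lambda>s. \<phi> (x, s)) t))"
        by (intro Bochner_Integration.integral_cong refl) auto
      also have "\<dots> = - (LINT (x, t)|lebesgue. u x t * deriv (\<lambda>s. \<phi> (x, s)) t)"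
        by (rule Bochner_Integration.integral_minus)
      finally show ?thesis unfolding dt_pairing_def by simp
    qed
    also have "\<dots> = - (LINT (x, t)|lebesgue. (conv J (\<lambda>y. u y t) x - u x t) * \<phi> (x, t))"
      by (simp only: strong_solution_dt_pairing[OF u \<phi>])
    also have "\<dots> = (LINT p|lebesgue. - (case p of (x, t) \<Rightarrow> (conv J (\<lambda>y. u y t) x - u x t) * \<phi> (x, t)))"
      by (rule Bochner_Integration.integral_minus[symmetric])
    also have "\<dots> = (LINT (x, t)|lebesgue. (conv J (\<lambda>y. - u y t) x - - u x t) * \<phi> (x, t))"
      by (intro Bochner_Integration.integral_cong refl) (auto simp: conv_minus algebra_simps)
    finally show ?thesis .
  qed
  with conv' show "supersolution J (\<lambda>x t. - u x t)"
    unfolding supersolution_def by simp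
qed

section \<open>A Gronwall lemma for extended nonnegative functions\<close>

lemma nn_integral_exp_tail:
  "(\<integral>\<^sup>+t. ennreal (exp (- (2 * t))) * indicator {s..} t \<partial>lborel) = ennreal (exp (- (2 * s)) / 2)"
proof -
  have "((\<lambda>t::real. - exp (- (2 * t)) / 2) \<longlongrightarrow> - 0 / 2) at_top"
    by (intro tendsto_intros filterlim_compose[OF exp_at_bot])
       (auto simp: filterlim_uminus_at_bot intro!: filterlim_tendsto_pos_mult_at_top[OF tendsto_const] filterlim_ident)
  then have "(\<integral>\<^sup>+t. ennreal (exp (- (2 * t))) * indicator {s..} t \<partial>lborel) = ennreal (0 - (- exp (- (2 * s)) / 2))"
    by (intro nn_integral_FTC_atLeast) (auto intro!: derivative_eq_intros)
  then show ?thesis by simp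
qed

text \<open>
  Let \<open>I\<close> be the integral of \<open>e\<^sup>-\<^sup>2\<^sup>t H(t)\<close> over the interval. Inserting the inequality and
  exchanging the order of integration gives \<open>I \<le> I / 2\<close>, because the integral of \<open>e\<^sup>-\<^sup>2\<^sup>t\<close> over
  \<open>t > s\<close> is half of \<open>e\<^sup>-\<^sup>2\<^sup>s\<close>. As \<open>I\<close> is finite, it vanishes.
\<close>

lemma nn_integral_gronwall:
  fixes H :: "real \<Rightarrow> ennreal"
  assumes H [measurable]: "H \<in> borel_measurable borel"
    and ineq: "AE t in lborel. t \<in> {0<..T} \<longrightarrow> H t \<le> (\<integral>\<^sup>+s. indicator {0<..<t} s * H s \<partial>lborel)"
    and fin: "(\<integral>\<^sup>+t. indicator {0<..T} t * H t \<partial>lborel) < \<infinity>"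
  shows "(\<integral>\<^sup>+t. indicator {0<..T} t * H t \<partial>lborel) = 0"
proof -
  let ?e = "\<lambda>t::real. ennreal (exp (- (2 * t)))"
  define I where "I = (\<integral>\<^sup>+t. indicator {0<..T} t * (?e t * H t) \<partial>lborel)"
  have "I \<le> (\<integral>\<^sup>+t. indicator {0<..T} t * H t \<partial>lborel)"
    unfolding I_def
  proof (intro nn_integral_mono)
    fix t :: real
    have "?e t * H t \<le> 1 * H t" if "0 < t"
      using that by (intro mult_right_mono) auto
    then show "indicator {0<..T} t * (?e t * H t) \<le> indicator {0<..T} t * H t"
      by (auto simp: indicator_def)
  qed
  with fin have I_fin: "I < \<infinity>" by simp
  have "I \<le> (\<integral>\<^sup>+t. indicator {0<..T} t * (?e t * (\<integral>\<^sup>+s. indicator {0<..<t} s * H s \<partial>lborel)) \<partial>lborel)"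
    unfolding I_def
  proof (rule nn_integral_mono_AE)
    show "AE t in lborel. indicator {0<..T} t * (?e t * H t)
        \<le> indicator {0<..T} t * (?e t * (\<integral>\<^sup>+s. indicator {0<..<t} s * H s \<partial>lborel))"
      using ineq by eventually_elim (auto simp: indicator_def intro!: mult_left_mono)
  qed
  also have "\<dots> = (\<integral>\<^sup>+t. (\<integral>\<^sup>+s. (indicator {0<..T} t * ?e t) * (if 0 < s \<and> s < t then H s else 0) \<partial>lborel) \<partial>lborel)"
  proof (intro nn_integral_cong)
    fix t :: real
    have "(\<integral>\<^sup>+s. indicator {0<..<t} s * H s \<partial>lborel) = (\<integral>\<^sup>+s. (if 0 < s \<and> s < t then H s else 0) \<partial>lborel)"
      by (intro nn_integral_cong) (auto simp: indicator_def)
    then show "indicator {0<..T} t * (?e t * (\<integral>\<^sup>+s. indicator {0<..<t} s * H s \<partial>lborel))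
      = (\<integral>\<^sup>+s. (indicator {0<..T} t * ?e t) * (if 0 < s \<and> s < t then H s else 0) \<partial>lborel)"
      by (subst nn_integral_cmult) (auto simp: mult.assoc)
  qed
  also have "\<dots> = (\<integral>\<^sup>+s. (\<integral>\<^sup>+t. (indicator {0<..T} t * ?e t) * (if 0 < s \<and> s < t then H s else 0) \<partial>lborel) \<partial>lborel)"
    by (rule lborel_pair.Fubini') measurable
  also have "\<dots> \<le> (\<integral>\<^sup>+s. indicator {0<..T} s * H s * (?e s * ennreal (1/2)) \<partial>lborel)"
  proof (intro nn_integral_mono)
    fix s :: real
    have "(\<integral>\<^sup>+t. (indicator {0<..T} t * ?e t) * (if 0 < s \<and> s < t then H s else 0) \<partial>lborel)
        \<le> (\<integral>\<^sup>+t. (indicator {0<..T} s * H s) * (?e t * indicator {s..} t) \<partial>lborel)"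
      by (intro nn_integral_mono) (auto simp: indicator_def mult_ac)
    also have "\<dots> = (indicator {0<..T} s * H s) * ennreal (exp (- (2 * s)) / 2)"
      by (subst nn_integral_cmult) (auto simp: nn_integral_exp_tail)
    also have "ennreal (exp (- (2 * s)) / 2) = ?e s * ennreal (1/2)"
      by (subst ennreal_mult[symmetric]) auto
    finally show "(\<integral>\<^sup>+t. (indicator {0<..T} t * ?e t) * (if 0 < s \<and> s < t then H s else 0) \<partial>lborel)
        \<le> indicator {0<..T} s * H s * (?e s * ennreal (1/2))" .
  qed
  also have "\<dots> = (\<integral>\<^sup>+s. (indicator {0<..T} s * (?e s * H s)) * ennreal (1/2) \<partial>lborel)"
    by (intro nn_integral_cong) (simp add: mult_ac)
  also have "\<dots> = I * ennreal (1/2)"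
    unfolding I_def by (rule nn_integral_multc) measurable
  finally have half: "I \<le> I * ennreal (1/2)" .
  have "I = 0"
  proof -
    obtain r where r: "I = ennreal r" "0 \<le> r"
      using I_fin by (cases I) auto
    then have "ennreal r \<le> ennreal (r * (1/2))"
      using half by (subst ennreal_mult) auto
    then show ?thesis using r by simp
  qed
  then have "AE t in lborel. indicator {0<..T} t * (?e t * H t) = 0"
    unfolding I_def by (subst (asm) nn_integral_0_iff_AE) auto
  then have "AE t in lborel. indicator {0<..T} t * H t = 0"
    by eventually_elim (auto simp: indicator_def)
  then show ?thesis
    by (subst nn_integral_0_iff_AE) auto
qed

lemma ennreal_integral_le_nn_integral:
  fixes f :: "'b \<Rightarrow> real"
  assumes "integrable M f"
  shows "ennreal (integral\<^sup>L M f) \<le> (\<integral>\<^sup>+x. ennreal (f x) \<partial>M)"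
proof -
  have "integral\<^sup>L M f \<le> (LINT x|M. max 0 (f x))"
    using assms by (intro integral_mono) auto
  then have "ennreal (integral\<^sup>L M f) \<le> ennreal (LINT x|M. max 0 (f x))"
    by (rule ennreal_leI)
  also have "\<dots> = (\<integral>\<^sup>+x. ennreal (max 0 (f x)) \<partial>M)"
    using assms by (intro nn_integral_eq_integral[symmetric]) auto
  also have "\<dots> = (\<integral>\<^sup>+x. ennreal (f x) \<partial>M)"
    by (intro nn_integral_cong) (auto simp: max_def ennreal_neg)
  finally show ?thesis .
qed

section \<open>Strong solutions in mild form\<close>

lemma cont_in_time_diff:
  fixes u v :: "'a::euclidean_space \<Rightarrow> real \<Rightarrow> real"
  assumes u: "cont_in_time_L1loc u" and v: "cont_in_time_L1loc v"
  shows "cont_in_time_L1loc (\<lambda>x t. u x t - v x t)"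
  unfolding cont_in_time_L1loc_def
proof (intro conjI allI impI)
  fix t :: real assume "0 \<le> t"
  then show "L1loc UNIV (\<lambda>x. u x t - v x t)"
    using u v unfolding cont_in_time_L1loc_def L1loc_def by (auto intro: set_integral_diff(1))
next
  fix K :: "'a set" and s :: real assume K: "compact K" and s: "0 \<le> s"
  let ?U = "\<lambda>t. LINT x:K|lebesgue. \<bar>u x t - u x s\<bar>" and ?V = "\<lambda>t. LINT x:K|lebesgue. \<bar>v x t - v x s\<bar>"
  show "((\<lambda>t. LINT x:K|lebesgue. \<bar>u x t - v x t - (u x s - v x s)\<bar>) \<longlongrightarrow> 0) (at s within {0..})"
  proof (rule Lim_null_comparison)
    have "((\<lambda>t. ?U t + ?V t) \<longlongrightarrow> 0 + 0) (at s within {0..})"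
      using u v K s unfolding cont_in_time_L1loc_def by (intro tendsto_add) blast+
    then show "((\<lambda>t. ?U t + ?V t) \<longlongrightarrow> 0) (at s within {0..})" by simp
    show "\<forall>\<^sub>F t in at s within {0..}. norm (LINT x:K|lebesgue. \<bar>u x t - v x t - (u x s - v x s)\<bar>) \<le> ?U t + ?V t"
      unfolding eventually_at
    proof (intro exI[of _ 1] conjI ballI impI)
      fix t :: real assume "t \<in> {0..}"
      then have t: "0 \<le> t" by simp
      note int = cont_in_time_slice[OF u K t] cont_in_time_slice[OF v K t]
        cont_in_time_slice[OF u K s] cont_in_time_slice[OF v K s]
      have iu: "set_integrable lebesgue K (\<lambda>x. \<bar>u x t - u x s\<bar>)"
        and iv: "set_integrable lebesgue K (\<lambda>x. \<bar>v x t - v x s\<bar>)"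
        and iuv: "set_integrable lebesgue K (\<lambda>x. \<bar>u x t - v x t - (u x s - v x s)\<bar>)"
        by (intro set_integrable_abs set_integral_diff(1) int)+
      have "norm (LINT x:K|lebesgue. \<bar>u x t - v x t - (u x s - v x s)\<bar>) = (LINT x:K|lebesgue. \<bar>u x t - v x t - (u x s - v x s)\<bar>)"
        unfolding set_lebesgue_integral_def by (simp add: integral_nonneg_AE)
      also have "\<dots> \<le> (LINT x:K|lebesgue. \<bar>u x t - u x s\<bar> + \<bar>v x t - v x s\<bar>)"
        by (intro set_integral_mono iuv set_integral_add(1) iu iv) auto
      also have "\<dots> = ?U t + ?V t"
        by (rule set_integral_add(2)[OF iu iv])
      finally show "norm (LINT x:K|lebesgue. \<bar>u x t - v x t - (u x s - v x s)\<bar>) \<le> ?U t + ?V t" .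
    qed simp
  qed
qed

lemma cont_in_time_abs:
  fixes u :: "'a::euclidean_space \<Rightarrow> real \<Rightarrow> real"
  assumes u: "cont_in_time_L1loc u"
  shows "cont_in_time_L1loc (\<lambda>x t. \<bar>u x t\<bar>)"
  unfolding cont_in_time_L1loc_def
proof (intro conjI allI impI)
  fix t :: real assume "0 \<le> t"
  then show "L1loc UNIV (\<lambda>x. \<bar>u x t\<bar>)"
    using u unfolding cont_in_time_L1loc_def L1loc_def by (auto intro: set_integrable_abs)
next
  fix K :: "'a set" and s :: real assume K: "compact K" and s: "0 \<le> s"
  show "((\<lambda>t. LINT x:K|lebesgue. \<bar>\<bar>u x t\<bar> - \<bar>u x s\<bar>\<bar>) \<longlongrightarrow> 0) (at s within {0..})"
  proof (rule Lim_null_comparison)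
    show "((\<lambda>t. LINT x:K|lebesgue. \<bar>u x t - u x s\<bar>) \<longlongrightarrow> 0) (at s within {0..})"
      using u K s unfolding cont_in_time_L1loc_def by blast
    show "\<forall>\<^sub>F t in at s within {0..}. norm (LINT x:K|lebesgue. \<bar>\<bar>u x t\<bar> - \<bar>u x s\<bar>\<bar>) \<le> (LINT x:K|lebesgue. \<bar>u x t - u x s\<bar>)"
      unfolding eventually_at
    proof (intro exI[of _ 1] conjI ballI impI)
      fix t :: real assume "t \<in> {0..}"
      then have t: "0 \<le> t" by simp
      note int = cont_in_time_slice[OF u K t] cont_in_time_slice[OF u K s]
      have "norm (LINT x:K|lebesgue. \<bar>\<bar>u x t\<bar> - \<bar>u x s\<bar>\<bar>) = (LINT x:K|lebesgue. \<bar>\<bar>u x t\<bar> - \<bar>u x s\<bar>\<bar>)"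
        unfolding set_lebesgue_integral_def by (simp add: integral_nonneg_AE)
      also have "\<dots> \<le> (LINT x:K|lebesgue. \<bar>u x t - u x s\<bar>)"
        by (intro set_integral_mono set_integrable_abs set_integral_diff(1) int) auto
      finally show "norm (LINT x:K|lebesgue. \<bar>\<bar>u x t\<bar> - \<bar>u x s\<bar>\<bar>) \<le> (LINT x:K|lebesgue. \<bar>u x t - u x s\<bar>)" .
    qed simp
  qed
qed

text \<open>
  Both \<open>u\<close> and \<open>- u\<close> are supersolutions, so the two Duhamel inequalities combine to an
  equality.
\<close>

lemma strong_solution_mild:
  fixes u :: "'a::euclidean_space \<Rightarrow> real \<Rightarrow> real"
  assumes u: "strong_solution J u0 u" and "0 < c" "c < d"
  shows "AE x in lebesgue.
    set_integrable lebesgue {c..d} (\<lambda>s. conv J (\<lambda>y. u y s) x * exp s) \<and>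
    (LINT s:{c..d}|lebesgue. conv J (\<lambda>y. u y s) x * exp s) = exp d * u x d - exp c * u x c"
proof -
  have loc: "L1loc (UNIV \<times> {0<..}) (\<lambda>(x, t). u x t)" and cont: "cont_in_time_L1loc u"
    using u unfolding strong_solution_def by auto
  have slice: "set_integrable lebesgue (cbox a b) (\<lambda>x. u x t)" if "0 < t" for a b t
    using cont_in_time_slice[OF cont compact_cbox] that by simp
  have cont': "continuous_on {0<..} (\<lambda>t. LINT x:cbox a b|lebesgue. u x t)" for a b
    by (rule continuous_on_subset[OF cont_in_time_integral[OF cont compact_cbox]]) auto
  have "L1loc (UNIV \<times> {0<..}) (\<lambda>(x, t). - u x t)"
    using loc unfolding L1loc_def by (auto simp: case_prod_beta set_integrable_def)
  moreover have "set_integrable lebesgue (cbox a b) (\<lambda>x. - u x t)" if "0 < t" for a b t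
    using slice[OF that] by (simp add: set_integrable_def)
  moreover have "continuous_on {0<..} (\<lambda>t. LINT x:cbox a b|lebesgue. - u x t)" for a b
    using continuous_on_minus[OF cont'] by (simp add: set_lebesgue_integral_def)
  ultimately have "AE x in lebesgue.
      set_integrable lebesgue {c..d} (\<lambda>s. conv J (\<lambda>y. - u y s) x * exp s) \<and>
      (LINT s:{c..d}|lebesgue. conv J (\<lambda>y. - u y s) x * exp s) \<le> exp d * - u x d - exp c * - u x c"
    by (intro supersolution_duhamel[OF strong_solution_supersolution(2)[OF u]] \<open>0 < c\<close> \<open>c < d\<close>)
  moreover have "AE x in lebesgue.
      set_integrable lebesgue {c..d} (\<lambda>s. conv J (\<lambda>y. u y s) x * exp s) \<and>
      (LINT s:{c..d}|lebesgue. conv J (\<lambda>y. u y s) x * exp s) \<le> exp d * u x d - exp c * u x c"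
    by (intro supersolution_duhamel[OF strong_solution_supersolution(1)[OF u] loc] slice cont' \<open>0 < c\<close> \<open>c < d\<close>)
  ultimately show ?thesis
    by eventually_elim (simp add: conv_minus set_lebesgue_integral_def)
qed

section \<open>Comparison with the supersolution\<close>

lemma ennreal_add_le: "0 \<le> a \<Longrightarrow> ennreal (a + b) \<le> ennreal a + ennreal b"
  by (cases "0 \<le> b") (auto simp: ennreal_plus[symmetric] ennreal_neg intro: ennreal_leI simp del: ennreal_plus)

text \<open>
  The triangle inequality applied to the mild form of \<open>w = u - v\<close>, minus \<open>\<delta>\<close> times the Duhamel
  inequality of \<open>\<psi>\<close>. The coercion \<open>ennreal\<close> sends negative numbers to 0, so the inner integral on
  the right involves the positive part of \<open>h = \<bar>w\<bar> - \<delta> \<psi>\<close> only, and the integral exists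
  without further conditions.
\<close>

lemma difference_pointwise_ineq:
  fixes J :: "'a::euclidean_space \<Rightarrow> real"
  assumes J_nonneg: "\<And>x. 0 \<le> J x"
    and u: "strong_solution J u0 u" and v: "strong_solution J v0 v"
    and psi_cont: "continuous_on (UNIV \<times> {0..}) (\<lambda>(x, t). \<psi> x t)"
    and psi_nonneg: "\<And>x t. 0 \<le> t \<Longrightarrow> 0 \<le> \<psi> x t"
    and psi_super: "supersolution J \<psi>"
    and "0 \<le> \<delta>" "0 < c" "c < d"
  shows "AE x in lebesgue.
    ennreal (exp d * (\<bar>u x d - v x d\<bar> - \<delta> * \<psi> x d)) \<le>
      ennreal (exp c * \<bar>u x c - v x c\<bar>) +
      (\<integral>\<^sup>+s. indicator {c..d} s * (ennreal (exp s) *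
         (\<integral>\<^sup>+y. ennreal (J (x - y) * (\<bar>u y s - v y s\<bar> - \<delta> * \<psi> y s)) \<partial>lebesgue)) \<partial>lebesgue)"
proof -
  have loc: "L1loc (UNIV \<times> {0<..}) (\<lambda>(x, t). \<psi> x t)"
    by (rule continuous_L1loc(1)[OF psi_cont])
  have slice: "set_integrable lebesgue (cbox a b) (\<lambda>x. \<psi> x t)" if "0 < t" for a b t
    using continuous_L1loc(2)[OF psi_cont] that by simp
  have cont: "continuous_on {0<..} (\<lambda>t. LINT x:cbox a b|lebesgue. \<psi> x t)" for a b
    by (rule continuous_on_subset[OF continuous_L1loc(3)[OF psi_cont]]) auto
  have P: "AE x in lebesgue.
      set_integrable lebesgue {c..d} (\<lambda>s. conv J (\<lambda>y. \<psi> y s) x * exp s) \<and>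
      (LINT s:{c..d}|lebesgue. conv J (\<lambda>y. \<psi> y s) x * exp s) \<le> exp d * \<psi> x d - exp c * \<psi> x c"
    by (intro supersolution_duhamel[OF psi_super loc] slice cont \<open>0 < c\<close> \<open>c < d\<close>)
  have conv_int: "AE x in lebesgue. AE s in lebesgue. 0 < s \<longrightarrow> integrable lebesgue (\<lambda>y. J (x - y) * f y s)"
    if "conv_L1loc J f" for f
    using AE_lebesgue_pair(1) that unfolding conv_L1loc_def by fastforce
  have cu: "AE x in lebesgue. AE s in lebesgue. 0 < s \<longrightarrow> integrable lebesgue (\<lambda>y. J (x - y) * u y s)"
    and cv: "AE x in lebesgue. AE s in lebesgue. 0 < s \<longrightarrow> integrable lebesgue (\<lambda>y. J (x - y) * v y s)"
    and cp: "AE x in lebesgue. AE s in lebesgue. 0 < s \<longrightarrow> integrable lebesgue (\<lambda>y. J (x - y) * \<psi> y s)"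
    using u v psi_super unfolding strong_solution_def supersolution_def by (blast intro: conv_int)+
  from P strong_solution_mild[OF u \<open>0 < c\<close> \<open>c < d\<close>] strong_solution_mild[OF v \<open>0 < c\<close> \<open>c < d\<close>] cu cv cp
  show ?thesis
  proof eventually_elim
    fix x
    let ?h = "\<lambda>y s. \<bar>u y s - v y s\<bar> - \<delta> * \<psi> y s"
    define U where "U s = conv J (\<lambda>y. u y s) x" for s
    define V where "V s = conv J (\<lambda>y. v y s) x" for s
    define P where "P s = conv J (\<lambda>y. \<psi> y s) x" for s
    assume "set_integrable lebesgue {c..d} (\<lambda>s. conv J (\<lambda>y. \<psi> y s) x * exp s) \<and>
      (LINT s:{c..d}|lebesgue. conv J (\<lambda>y. \<psi> y s) x * exp s) \<le> exp d * \<psi> x d - exp c * \<psi> x c"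
    then have P: "set_integrable lebesgue {c..d} (\<lambda>s. P s * exp s)"
      "(LINT s:{c..d}|lebesgue. P s * exp s) \<le> exp d * \<psi> x d - exp c * \<psi> x c" by (auto simp: P_def)
    assume "set_integrable lebesgue {c..d} (\<lambda>s. conv J (\<lambda>y. u y s) x * exp s) \<and>
      (LINT s:{c..d}|lebesgue. conv J (\<lambda>y. u y s) x * exp s) = exp d * u x d - exp c * u x c"
    then have U: "set_integrable lebesgue {c..d} (\<lambda>s. U s * exp s)"
      "(LINT s:{c..d}|lebesgue. U s * exp s) = exp d * u x d - exp c * u x c" by (auto simp: U_def)
    assume "set_integrable lebesgue {c..d} (\<lambda>s. conv J (\<lambda>y. v y s) x * exp s) \<and>
      (LINT s:{c..d}|lebesgue. conv J (\<lambda>y. v y s) x * exp s) = exp d * v x d - exp c * v x c"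
    then have V: "set_integrable lebesgue {c..d} (\<lambda>s. V s * exp s)"
      "(LINT s:{c..d}|lebesgue. V s * exp s) = exp d * v x d - exp c * v x c" by (auto simp: V_def)
    assume ae: "AE s in lebesgue. 0 < s \<longrightarrow> integrable lebesgue (\<lambda>y. J (x - y) * u y s)"
      "AE s in lebesgue. 0 < s \<longrightarrow> integrable lebesgue (\<lambda>y. J (x - y) * v y s)"
      "AE s in lebesgue. 0 < s \<longrightarrow> integrable lebesgue (\<lambda>y. J (x - y) * \<psi> y s)"
    have UV: "set_integrable lebesgue {c..d} (\<lambda>s. U s * exp s - V s * exp s)"
      by (rule set_integral_diff(1)[OF U(1) V(1)])
    have dP: "set_integrable lebesgue {c..d} (\<lambda>s. \<delta> * (P s * exp s))"
      using P(1) by (intro set_integrable_mult_right)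
    define k where "k s = \<bar>U s * exp s - V s * exp s\<bar> - \<delta> * (P s * exp s)" for s
    have k: "set_integrable lebesgue {c..d} k"
      unfolding k_def by (rule set_integral_diff(1)[OF set_integrable_abs[OF UV] dP])
    have "(LINT s:{c..d}|lebesgue. U s * exp s - V s * exp s)
        = exp d * (u x d - v x d) - exp c * (u x c - v x c)"
      unfolding set_integral_diff(2)[OF U(1) V(1)] U(2) V(2) by (simp add: algebra_simps)
    moreover have "\<bar>LINT s:{c..d}|lebesgue. U s * exp s - V s * exp s\<bar>
        \<le> (LINT s:{c..d}|lebesgue. \<bar>U s * exp s - V s * exp s\<bar>)"
      using set_integral_norm_bound[OF UV] by simp
    ultimately have "\<bar>exp d * (u x d - v x d)\<bar> - \<bar>exp c * (u x c - v x c)\<bar>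
        \<le> (LINT s:{c..d}|lebesgue. \<bar>U s * exp s - V s * exp s\<bar>)"
      by linarith
    then have w: "exp d * \<bar>u x d - v x d\<bar>
        \<le> exp c * \<bar>u x c - v x c\<bar> + (LINT s:{c..d}|lebesgue. \<bar>U s * exp s - V s * exp s\<bar>)"
      by (simp add: abs_mult)
    have "(LINT s:{c..d}|lebesgue. k s)
        = (LINT s:{c..d}|lebesgue. \<bar>U s * exp s - V s * exp s\<bar>) - \<delta> * (LINT s:{c..d}|lebesgue. P s * exp s)"
      unfolding k_def by (simp only: set_integral_diff(2)[OF set_integrable_abs[OF UV] dP] set_integral_mult_right)
    moreover have "\<delta> * (LINT s:{c..d}|lebesgue. P s * exp s) \<le> \<delta> * (exp d * \<psi> x d)"
      using P(2) psi_nonneg[of c x] \<open>0 < c\<close> \<open>0 \<le> \<delta>\<close>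
      by (intro mult_left_mono) (auto intro: order_trans)
    ultimately have "exp d * ?h x d \<le> exp c * \<bar>u x c - v x c\<bar> + (LINT s:{c..d}|lebesgue. k s)"
      using w by (simp add: algebra_simps)
    then have "ennreal (exp d * ?h x d) \<le> ennreal (exp c * \<bar>u x c - v x c\<bar> + (LINT s:{c..d}|lebesgue. k s))"
      by (rule ennreal_leI)
    also have "\<dots> \<le> ennreal (exp c * \<bar>u x c - v x c\<bar>) + ennreal (LINT s:{c..d}|lebesgue. k s)"
      by (rule ennreal_add_le) simp
    also have "ennreal (LINT s:{c..d}|lebesgue. k s) \<le> (\<integral>\<^sup>+s. ennreal (indicator {c..d} s *\<^sub>R k s) \<partial>lebesgue)"
      unfolding set_lebesgue_integral_def
      by (rule ennreal_integral_le_nn_integral) (use k in \<open>simp add: set_integrable_def\<close>)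
    also have "\<dots> \<le> (\<integral>\<^sup>+s. indicator {c..d} s * (ennreal (exp s) *
         (\<integral>\<^sup>+y. ennreal (J (x - y) * ?h y s) \<partial>lebesgue)) \<partial>lebesgue)"
    proof (rule nn_integral_mono_AE)
      show "AE s in lebesgue. ennreal (indicator {c..d} s *\<^sub>R k s) \<le> indicator {c..d} s * (ennreal (exp s) *
         (\<integral>\<^sup>+y. ennreal (J (x - y) * ?h y s) \<partial>lebesgue))"
        using ae
      proof eventually_elim
        fix s
        assume "0 < s \<longrightarrow> integrable lebesgue (\<lambda>y. J (x - y) * u y s)"
          "0 < s \<longrightarrow> integrable lebesgue (\<lambda>y. J (x - y) * v y s)"
          "0 < s \<longrightarrow> integrable lebesgue (\<lambda>y. J (x - y) * \<psi> y s)"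
        then have int: "integrable lebesgue (\<lambda>y. J (x - y) * u y s)"
          "integrable lebesgue (\<lambda>y. J (x - y) * v y s)"
          "integrable lebesgue (\<lambda>y. J (x - y) * \<psi> y s)" if "s \<in> {c..d}"
          using that \<open>0 < c\<close> by auto
        show "ennreal (indicator {c..d} s *\<^sub>R k s) \<le> indicator {c..d} s * (ennreal (exp s) *
         (\<integral>\<^sup>+y. ennreal (J (x - y) * ?h y s) \<partial>lebesgue))"
        proof (cases "s \<in> {c..d}")
          case True
          note int = int[OF True]
          have Jw: "integrable lebesgue (\<lambda>y. \<bar>J (x - y) * u y s - J (x - y) * v y s\<bar>)"
            by (intro integrable_abs Bochner_Integration.integrable_diff int)
          have Jp: "integrable lebesgue (\<lambda>y. \<delta> * (J (x - y) * \<psi> y s))"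
            using int(3) by simp
          have eq: "\<bar>J (x - y) * u y s - J (x - y) * v y s\<bar> - \<delta> * (J (x - y) * \<psi> y s) = J (x - y) * ?h y s" for y
          proof -
            have "\<bar>J (x - y) * u y s - J (x - y) * v y s\<bar> = J (x - y) * \<bar>u y s - v y s\<bar>"
              unfolding right_diff_distrib[symmetric] abs_mult using J_nonneg[of "x - y"] by simp
            then show ?thesis by (simp add: algebra_simps)
          qed
          have "\<bar>U s - V s\<bar> \<le> (LINT y|lebesgue. \<bar>J (x - y) * u y s - J (x - y) * v y s\<bar>)"
            unfolding U_def V_def conv_def Bochner_Integration.integral_diff[OF int(1,2), symmetric]
            by (rule integral_abs_bound)
          then have "\<bar>U s - V s\<bar> - \<delta> * P s
              \<le> (LINT y|lebesgue. \<bar>J (x - y) * u y s - J (x - y) * v y s\<bar>) - (LINT y|lebesgue. \<delta> * (J (x - y) * \<psi> y s))"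
            unfolding P_def conv_def by simp
          also have "\<dots> = (LINT y|lebesgue. J (x - y) * ?h y s)"
            unfolding Bochner_Integration.integral_diff[OF Jw Jp, symmetric] eq ..
          finally have "ennreal (\<bar>U s - V s\<bar> - \<delta> * P s) \<le> ennreal (LINT y|lebesgue. J (x - y) * ?h y s)"
            by (rule ennreal_leI)
          also have "\<dots> \<le> (\<integral>\<^sup>+y. ennreal (J (x - y) * ?h y s) \<partial>lebesgue)"
            using Bochner_Integration.integrable_diff[OF Jw Jp] unfolding eq by (rule ennreal_integral_le_nn_integral)
          finally have *: "ennreal (\<bar>U s - V s\<bar> - \<delta> * P s) \<le> (\<integral>\<^sup>+y. ennreal (J (x - y) * ?h y s) \<partial>lebesgue)" .
          have "k s = exp s * (\<bar>U s - V s\<bar> - \<delta> * P s)"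
            unfolding k_def left_diff_distrib[symmetric] abs_mult by (simp add: algebra_simps)
          then have "ennreal (k s) = ennreal (exp s) * ennreal (\<bar>U s - V s\<bar> - \<delta> * P s)"
            by (simp add: ennreal_mult')
          also have "\<dots> \<le> ennreal (exp s) * (\<integral>\<^sup>+y. ennreal (J (x - y) * ?h y s) \<partial>lebesgue)"
            using * by (rule mult_left_mono) simp
          finally show ?thesis using True by simp
        qed simp
      qed
    qed
    finally show "ennreal (exp d * ?h x d) \<le> ennreal (exp c * \<bar>u x c - v x c\<bar>) +
      (\<integral>\<^sup>+s. indicator {c..d} s * (ennreal (exp s) * (\<integral>\<^sup>+y. ennreal (J (x - y) * ?h y s) \<partial>lebesgue)) \<partial>lebesgue)"
      by (simp add: add_left_mono)
  qed
qed

lemma nn_integral_translate: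
  fixes J :: "'a::euclidean_space \<Rightarrow> real"
  assumes J: "J \<in> borel_measurable borel"
  shows "(\<integral>\<^sup>+x. ennreal (J (x - y)) \<partial>lborel) = (\<integral>\<^sup>+x. ennreal (J x) \<partial>lborel)"
proof -
  have "(\<integral>\<^sup>+x. ennreal (J x) \<partial>lborel) = (\<integral>\<^sup>+x. ennreal (J x) \<partial>distr lborel borel ((+) (- y)))"
    by (simp add: lborel_distr_plus)
  also have "\<dots> = (\<integral>\<^sup>+x. ennreal (J (- y + x)) \<partial>lborel)"
    by (subst nn_integral_distr) (use J in auto)
  finally show ?thesis by simp
qed

lemma nn_integral_convolution_mass:
  fixes J :: "'a::euclidean_space \<Rightarrow> real"
  assumes J [measurable]: "J \<in> borel_measurable borel" and mass: "(\<integral>\<^sup>+x. ennreal (J x) \<partial>lborel) = 1"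
    and b [measurable]: "b \<in> borel_measurable borel"
  shows "(\<integral>\<^sup>+x. (\<integral>\<^sup>+y. ennreal (J (x - y)) * b y \<partial>lborel) \<partial>lborel) = (\<integral>\<^sup>+y. b y \<partial>lborel)"
proof -
  have "(\<integral>\<^sup>+x. (\<integral>\<^sup>+y. ennreal (J (x - y)) * b y \<partial>lborel) \<partial>lborel)
      = (\<integral>\<^sup>+y. (\<integral>\<^sup>+x. ennreal (J (x - y)) * b y \<partial>lborel) \<partial>lborel)"
    by (rule lborel_pair.Fubini'[symmetric]) measurable
  also have "\<dots> = (\<integral>\<^sup>+y. b y \<partial>lborel)"
    by (intro nn_integral_cong, subst nn_integral_multc) (auto simp: nn_integral_translate mass)
  finally show ?thesis .
qed

lemma set_integrable_imp_ennreal_measurable: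
  assumes "set_integrable M K f"
  shows "(\<lambda>x. indicator K x * ennreal (f x)) \<in> borel_measurable M"
proof -
  have "(\<lambda>x. indicator K x *\<^sub>R f x) \<in> borel_measurable M"
    using assms unfolding set_integrable_def by (rule borel_measurable_integrable)
  then have "(\<lambda>x. ennreal (indicator K x *\<^sub>R f x)) \<in> borel_measurable M"
    by measurable
  then show ?thesis
    by (rule back_subst[where P = "\<lambda>f. f \<in> borel_measurable M"]) (auto simp: fun_eq_iff indicator_def)
qed

text \<open>
  The set \<open>K \<times> (0, T]\<close> is exhausted by compact sets that stay away from time 0.
\<close>

lemma L1loc_imp_measurable:
  fixes h :: "'a::euclidean_space \<times> real \<Rightarrow> real"
  assumes h: "L1loc (UNIV \<times> {0<..}) h" and K: "compact K"
  shows "(\<lambda>p. indicator (K \<times> {0<..T}) p * h p) \<in> borel_measurable lebesgue"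
proof (rule borel_measurable_LIMSEQ_real)
  let ?C = "\<lambda>n::nat. K \<times> {inverse (real (Suc n))..T}"
  have pos: "{e..T} \<subseteq> {0<..T}" if "0 < e" for e :: real
    using that by auto
  have C_sub: "?C n \<subseteq> K \<times> {0<..T}" for n
    by (intro Sigma_mono subset_refl pos) simp
  show "(\<lambda>p. indicator (?C n) p *\<^sub>R h p) \<in> borel_measurable lebesgue" for n
  proof -
    have "compact (?C n)" "?C n \<subseteq> UNIV \<times> {0<..}"
      using C_sub[of n] by (auto intro!: compact_Times K)
    then have "set_integrable lebesgue (?C n) h"
      using h unfolding L1loc_def by blast
    then show ?thesis
      unfolding set_integrable_def by (rule borel_measurable_integrable)
  qed
  show "(\<lambda>n. indicator (?C n) p *\<^sub>R h p) \<longlonglongrightarrow> indicator (K \<times> {0<..T}) p * h p" for p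
  proof (cases "p \<in> K \<times> {0<..T}")
    case True
    then have "0 < snd p" by auto
    then obtain N where N: "inverse (real (Suc N)) < snd p"
      using reals_Archimedean by blast
    have "indicator (?C n) p *\<^sub>R h p = indicator (K \<times> {0<..T}) p * h p" if "N \<le> n" for n
    proof -
      have "inverse (real (Suc n)) \<le> inverse (real (Suc N))"
        using that by (intro le_imp_inverse_le) auto
      then have "inverse (real (Suc n)) < snd p" using N by (rule le_less_trans)
      then have "p \<in> ?C n" using True by (auto simp: mem_Times_iff)
      then show ?thesis using True by simp
    qed
    then show ?thesis
      by (intro tendsto_eventually) (auto simp: eventually_sequentially)
  next
    case False
    then have "p \<notin> ?C n" for n
      using C_sub by blast
    then show ?thesis using False by simp
  qed
qed

text \<open>
  Let \<open>H s\<close> be the integral of the positive part of \<open>e\<^sup>s h(\<cdot>, s)\<close>, where \<open>h = \<bar>w\<bar> - \<delta> \<psi>\<close>. Since \<open>h\<close> is not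
  positive off \<open>K\<close>, integrating \<open>difference_pointwise_ineq\<close> over \<open>K\<close> bounds \<open>H t\<close> by the
  integral of \<open>H\<close> over times before \<open>t\<close> plus a term with \<open>w(c)\<close>, which disappears as \<open>c\<close> tends
  to 0. Continuity in time of \<open>\<bar>w\<bar>\<close> in \<open>L\<^sup>1(K)\<close> bounds \<open>H\<close>, so Gronwall's lemma applies and
  the positive part vanishes, first for almost every time and then, by the same bound, at every time.
\<close>

lemma comparison_on_compact:
  fixes J :: "'a::euclidean_space \<Rightarrow> real"
  assumes J_cont: "continuous_on UNIV J"
    and J_nonneg: "\<And>x. 0 \<le> J x"
    and J_mass: "has_bochner_integral lebesgue J 1"
    and u: "strong_solution J u0 u" and v: "strong_solution J u0 v"
    and psi_cont: "continuous_on (UNIV \<times> {0..}) (\<lambda>(x, t). \<psi> x t)"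
    and psi_nonneg: "\<And>x t. 0 \<le> t \<Longrightarrow> 0 \<le> \<psi> x t"
    and psi_super: "supersolution J \<psi>"
    and "0 \<le> \<delta>" and K: "compact K" and "0 < d" "d \<le> T"
    and off_K: "AE t in lebesgue. t \<in> {0<..T} \<longrightarrow>
      (AE x in lebesgue. x \<notin> K \<longrightarrow> \<bar>u x t - v x t\<bar> \<le> \<delta> * \<psi> x t)"
  shows "AE x in lebesgue. x \<in> K \<longrightarrow> \<bar>u x d - v x d\<bar> \<le> \<delta> * \<psi> x d"
proof -
  define h where "h = (\<lambda>(x, t). \<bar>u x t - v x t\<bar> - \<delta> * \<psi> x t)"
  have uC: "cont_in_time_L1loc u" and vC: "cont_in_time_L1loc v"
    and uL: "L1loc (UNIV \<times> {0<..}) (\<lambda>(x, t). u x t)" and vL: "L1loc (UNIV \<times> {0<..}) (\<lambda>(x, t). v x t)"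
    and u0: "AE x in lebesgue. u x 0 = u0 x" and v0: "AE x in lebesgue. v x 0 = u0 x"
    using u v unfolding strong_solution_def by auto
  have pL: "L1loc (UNIV \<times> {0<..}) (\<lambda>(x, t). \<psi> x t)"
    by (rule continuous_L1loc(1)[OF psi_cont])
  have J_borel [measurable]: "J \<in> borel_measurable borel"
    using J_cont by (rule borel_measurable_continuous_onI)
  have J_nn: "(\<integral>\<^sup>+x. ennreal (J x) \<partial>lborel) = 1"
  proof -
    have "integrable lebesgue J" "integral\<^sup>L lebesgue J = 1"
      using J_mass by (auto simp: has_bochner_integral_iff)
    then have "(\<integral>\<^sup>+x. ennreal (J x) \<partial>lebesgue) = 1"
      using J_nonneg by (simp add: nn_integral_eq_integral)
    then show ?thesis by (simp add: nn_integral_completion)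
  qed
  have h_loc: "L1loc (UNIV \<times> {0<..}) h"
    unfolding L1loc_def
  proof (intro allI impI, elim conjE)
    fix C :: "('a \<times> real) set" assume C: "compact C" "C \<subseteq> UNIV \<times> {0<..}"
    have "set_integrable lebesgue C (\<lambda>(x, t). u x t)" "set_integrable lebesgue C (\<lambda>(x, t). v x t)"
      "set_integrable lebesgue C (\<lambda>(x, t). \<psi> x t)"
      using uL vL pL C unfolding L1loc_def by blast+
    then have "set_integrable lebesgue C (\<lambda>p. \<bar>(case p of (x, t) \<Rightarrow> u x t) - (case p of (x, t) \<Rightarrow> v x t)\<bar> - \<delta> * (case p of (x, t) \<Rightarrow> \<psi> x t))"
      by (intro set_integral_diff(1) set_integrable_abs set_integrable_mult_right)
    then show "set_integrable lebesgue C h"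
      by (rule back_subst[where P = "set_integrable lebesgue C"]) (auto simp: h_def fun_eq_iff)
  qed
  \<comment> \<open>Tonelli's theorem is applied to a Borel version \<open>B\<close> of the positive part of \<open>h\<close> on \<open>K\<close> and positive times.\<close>
  have h_meas: "(\<lambda>p. indicator (K \<times> {0<..T}) p * h p) \<in> borel_measurable lebesgue"
    using h_loc K by (rule L1loc_imp_measurable)
  then have "(\<lambda>p. ennreal (indicator (K \<times> {0<..T}) p * h p)) \<in> borel_measurable lebesgue"
    by measurable
  then obtain B where B [measurable]: "B \<in> borel_measurable lborel"
    and "AE p in lborel. ennreal (indicator (K \<times> {0<..T}) p * h p) = B p"
    using completion_ex_borel_measurable by blast
  then have hB: "AE p in lebesgue. ennreal (indicator (K \<times> {0<..T}) p * h p) = B p"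
    by (simp add: AE_completion_iff)
  have hB_slice: "AE s in lborel. s \<in> {0<..T} \<longrightarrow>
      (AE y in lborel. B (y, s) = ennreal (h (y, s)) \<and> B (y, s) = indicator K y * ennreal (h (y, s)))"
    using AE_lebesgue_pair(2)[OF hB] off_K unfolding AE_completion_iff
  proof eventually_elim
    fix s
    assume *: "AE y in lborel. ennreal (indicator (K \<times> {0<..T}) (y, s) * h (y, s)) = B (y, s)"
      "s \<in> {0<..T} \<longrightarrow> (AE x in lborel. x \<notin> K \<longrightarrow> \<bar>u x s - v x s\<bar> \<le> \<delta> * \<psi> x s)"
    show "s \<in> {0<..T} \<longrightarrow>
      (AE y in lborel. B (y, s) = ennreal (h (y, s)) \<and> B (y, s) = indicator K y * ennreal (h (y, s)))"
    proof
      assume s: "s \<in> {0<..T}"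
      from *(1) *(2)[rule_format, OF s]
      show "AE y in lborel. B (y, s) = ennreal (h (y, s)) \<and> B (y, s) = indicator K y * ennreal (h (y, s))"
      proof eventually_elim
        fix y
        assume "ennreal (indicator (K \<times> {0<..T}) (y, s) * h (y, s)) = B (y, s)"
          "y \<notin> K \<longrightarrow> \<bar>u y s - v y s\<bar> \<le> \<delta> * \<psi> y s"
        then show "B (y, s) = ennreal (h (y, s)) \<and> B (y, s) = indicator K y * ennreal (h (y, s))"
          using s by (cases "y \<in> K") (auto simp: h_def ennreal_neg)
      qed
    qed
  qed
  have B_pair [measurable]: "B \<in> borel_measurable (lborel \<Otimes>\<^sub>M lborel)"
    using B by (simp add: lborel_prod)
  define H where "H s = (\<integral>\<^sup>+y. ennreal (exp s) * B (y, s) \<partial>lborel)" for s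
  have H_meas [measurable]: "H \<in> borel_measurable borel"
    unfolding H_def by measurable
  define W where "W t = (LINT x:K|lebesgue. \<bar>u x t - v x t\<bar>)" for t
  have w_cont: "cont_in_time_L1loc (\<lambda>x t. \<bar>u x t - v x t\<bar>)"
    by (intro cont_in_time_abs cont_in_time_diff uC vC)
  have W_cont: "continuous_on {0..} W"
    unfolding W_def using w_cont K by (rule cont_in_time_integral)
  have W_0: "W 0 = 0"
  proof -
    have "AE x in lebesgue. indicator K x *\<^sub>R \<bar>u x 0 - v x 0\<bar> = 0"
      using u0 v0 by eventually_elim simp
    then show ?thesis
      unfolding W_def set_lebesgue_integral_def by (rule integral_eq_zero_AE)
  qed
  have w_meas: "(\<lambda>x. indicator K x * ennreal \<bar>u x t - v x t\<bar>) \<in> borel_measurable lebesgue" if "0 \<le> t" for t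
    using cont_in_time_slice[OF w_cont K that] by (rule set_integrable_imp_ennreal_measurable)
  have W_nn: "(\<integral>\<^sup>+x. ennreal r * (indicator K x * ennreal \<bar>u x t - v x t\<bar>) \<partial>lebesgue) = ennreal r * ennreal (W t)"
    if "0 \<le> t" for r t
  proof -
    have "(\<integral>\<^sup>+x. indicator K x * ennreal \<bar>u x t - v x t\<bar> \<partial>lebesgue)
        = (\<integral>\<^sup>+x. ennreal (indicator K x *\<^sub>R \<bar>u x t - v x t\<bar>) \<partial>lebesgue)"
      by (intro nn_integral_cong) (auto simp: indicator_def)
    also have "\<dots> = ennreal (W t)"
      unfolding W_def set_lebesgue_integral_def
      using cont_in_time_slice[OF w_cont K that]
      by (intro nn_integral_eq_integral) (auto simp: set_integrable_def)
    finally show ?thesis by (simp add: nn_integral_cmult[OF w_meas[OF that]])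
  qed
  have h_slice_meas: "(\<lambda>x. indicator K x * ennreal (exp t * h (x, t))) \<in> borel_measurable lebesgue" if "0 < t" for t
  proof -
    have t: "0 \<le> t" using that by simp
    have "set_integrable lebesgue K (\<lambda>x. \<psi> x t)"
    proof (rule set_integrable_compact_continuous[OF K])
      have "continuous_on K (\<lambda>x. case (x, t) of (x, t) \<Rightarrow> \<psi> x t)"
        by (rule continuous_on_compose2[OF psi_cont]) (use t in \<open>auto intro!: continuous_intros\<close>)
      then show "continuous_on K (\<lambda>x. \<psi> x t)" by simp
    qed
    then have "set_integrable lebesgue K (\<lambda>x. exp t * h (x, t))"
      unfolding h_def prod.case
      by (intro set_integrable_mult_right set_integral_diff(1) cont_in_time_slice[OF w_cont K t])
    then show ?thesis by (rule set_integrable_imp_ennreal_measurable)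
  qed
  have step: "(\<integral>\<^sup>+x. indicator K x * ennreal (exp t * h (x, t)) \<partial>lebesgue)
      \<le> ennreal (exp c * W c) + (\<integral>\<^sup>+s. indicator {0<..<t} s * H s \<partial>lborel)"
    if c: "0 < c" "c < t" and "t \<le> T" for c t
  proof -
    let ?R = "\<lambda>x. \<integral>\<^sup>+s. indicator {0<..<t} s * (ennreal (exp s) * (\<integral>\<^sup>+y. ennreal (J (x - y)) * B (y, s) \<partial>lborel)) \<partial>lborel"
    have R_meas: "?R \<in> borel_measurable borel" by measurable
    have R_ge: "(\<integral>\<^sup>+s. indicator {c..t} s * (ennreal (exp s) *
         (\<integral>\<^sup>+y. ennreal (J (x - y) * (\<bar>u y s - v y s\<bar> - \<delta> * \<psi> y s)) \<partial>lebesgue)) \<partial>lebesgue) \<le> ?R x" for x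
      unfolding nn_integral_completion
    proof (rule nn_integral_mono_AE)
      have "AE s in lborel. s \<noteq> t" by (rule AE_lborel_singleton)
      with hB_slice show "AE s in lborel. indicator {c..t} s * (ennreal (exp s) *
         (\<integral>\<^sup>+y. ennreal (J (x - y) * (\<bar>u y s - v y s\<bar> - \<delta> * \<psi> y s)) \<partial>lborel))
         \<le> indicator {0<..<t} s * (ennreal (exp s) * (\<integral>\<^sup>+y. ennreal (J (x - y)) * B (y, s) \<partial>lborel))"
      proof eventually_elim
        fix s
        assume *: "s \<in> {0<..T} \<longrightarrow>
          (AE y in lborel. B (y, s) = ennreal (h (y, s)) \<and> B (y, s) = indicator K y * ennreal (h (y, s)))" "s \<noteq> t"
        show "indicator {c..t} s * (ennreal (exp s) *
         (\<integral>\<^sup>+y. ennreal (J (x - y) * (\<bar>u y s - v y s\<bar> - \<delta> * \<psi> y s)) \<partial>lborel))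
         \<le> indicator {0<..<t} s * (ennreal (exp s) * (\<integral>\<^sup>+y. ennreal (J (x - y)) * B (y, s) \<partial>lborel))"
        proof (cases "s \<in> {c..t}")
          case True
          then have "s \<in> {0<..<t}" "s \<in> {0<..T}" using c \<open>t \<le> T\<close> \<open>s \<noteq> t\<close> by auto
          have "AE y in lborel. ennreal (J (x - y) * (\<bar>u y s - v y s\<bar> - \<delta> * \<psi> y s)) = ennreal (J (x - y)) * B (y, s)"
            using *(1)[rule_format, OF \<open>s \<in> {0<..T}\<close>]
            by eventually_elim (simp add: h_def ennreal_mult' J_nonneg)
          then have "(\<integral>\<^sup>+y. ennreal (J (x - y) * (\<bar>u y s - v y s\<bar> - \<delta> * \<psi> y s)) \<partial>lborel)
              = (\<integral>\<^sup>+y. ennreal (J (x - y)) * B (y, s) \<partial>lborel)"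
            by (rule nn_integral_cong_AE)
          then show ?thesis
            using True \<open>s \<in> {0<..<t}\<close> by simp
        qed simp
      qed
    qed
    have "(\<integral>\<^sup>+x. indicator K x * ennreal (exp t * h (x, t)) \<partial>lebesgue)
        \<le> (\<integral>\<^sup>+x. ennreal (exp c) * (indicator K x * ennreal \<bar>u x c - v x c\<bar>) + ?R x \<partial>lebesgue)"
    proof (rule nn_integral_mono_AE)
      have "AE x in lebesgue. ennreal (exp t * (\<bar>u x t - v x t\<bar> - \<delta> * \<psi> x t)) \<le>
            ennreal (exp c * \<bar>u x c - v x c\<bar>) +
            (\<integral>\<^sup>+s. indicator {c..t} s * (ennreal (exp s) *
              (\<integral>\<^sup>+y. ennreal (J (x - y) * (\<bar>u y s - v y s\<bar> - \<delta> * \<psi> y s)) \<partial>lebesgue)) \<partial>lebesgue)"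
        by (rule difference_pointwise_ineq[OF J_nonneg u v psi_cont _ psi_super \<open>0 \<le> \<delta>\<close> c])
           (rule psi_nonneg)
      then show "AE x in lebesgue. indicator K x * ennreal (exp t * h (x, t))
          \<le> ennreal (exp c) * (indicator K x * ennreal \<bar>u x c - v x c\<bar>) + ?R x"
      proof eventually_elim
        fix x
        assume "ennreal (exp t * (\<bar>u x t - v x t\<bar> - \<delta> * \<psi> x t)) \<le>
            ennreal (exp c * \<bar>u x c - v x c\<bar>) +
            (\<integral>\<^sup>+s. indicator {c..t} s * (ennreal (exp s) *
              (\<integral>\<^sup>+y. ennreal (J (x - y) * (\<bar>u y s - v y s\<bar> - \<delta> * \<psi> y s)) \<partial>lebesgue)) \<partial>lebesgue)"
        also have "\<dots> \<le> ennreal (exp c * \<bar>u x c - v x c\<bar>) + ?R x"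
          by (rule add_left_mono[OF R_ge])
        finally show "indicator K x * ennreal (exp t * h (x, t))
          \<le> ennreal (exp c) * (indicator K x * ennreal \<bar>u x c - v x c\<bar>) + ?R x"
          by (cases "x \<in> K") (auto simp: h_def ennreal_mult')
      qed
    qed
    also have "\<dots> = (\<integral>\<^sup>+x. ennreal (exp c) * (indicator K x * ennreal \<bar>u x c - v x c\<bar>) \<partial>lebesgue) + (\<integral>\<^sup>+x. ?R x \<partial>lebesgue)"
    proof (rule nn_integral_add)
      show "(\<lambda>x. ennreal (exp c) * (indicator K x * ennreal \<bar>u x c - v x c\<bar>)) \<in> borel_measurable lebesgue"
        by (rule borel_measurable_times_ennreal[OF borel_measurable_const w_meas]) (use c in simp)
      show "?R \<in> borel_measurable lebesgue" using R_meas by (rule borel_lebesgue)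
    qed
    also have "(\<integral>\<^sup>+x. ennreal (exp c) * (indicator K x * ennreal \<bar>u x c - v x c\<bar>) \<partial>lebesgue) = ennreal (exp c * W c)"
      using c by (simp add: W_nn ennreal_mult')
    also have "(\<integral>\<^sup>+x. ?R x \<partial>lebesgue) = (\<integral>\<^sup>+s. indicator {0<..<t} s * H s \<partial>lborel)"
    proof -
      have "(\<integral>\<^sup>+x. ?R x \<partial>lebesgue)
          = (\<integral>\<^sup>+s. \<integral>\<^sup>+x. indicator {0<..<t} s * (ennreal (exp s) * (\<integral>\<^sup>+y. ennreal (J (x - y)) * B (y, s) \<partial>lborel)) \<partial>lborel \<partial>lborel)"
        unfolding nn_integral_completion by (rule lborel_pair.Fubini'[symmetric]) measurable
      also have "\<dots> = (\<integral>\<^sup>+s. indicator {0<..<t} s * H s \<partial>lborel)"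
      proof (intro nn_integral_cong)
        fix s :: real
        have *: "(\<integral>\<^sup>+x. (\<integral>\<^sup>+y. ennreal (J (x - y)) * B (y, s) \<partial>lborel) \<partial>lborel) = (\<integral>\<^sup>+y. B (y, s) \<partial>lborel)"
          by (rule nn_integral_convolution_mass[OF J_borel J_nn]) measurable
        show "(\<integral>\<^sup>+x. indicator {0<..<t} s * (ennreal (exp s) * (\<integral>\<^sup>+y. ennreal (J (x - y)) * B (y, s) \<partial>lborel)) \<partial>lborel)
            = indicator {0<..<t} s * H s"
          unfolding H_def by (simp add: nn_integral_cmult *)
      qed
      finally show ?thesis .
    qed
    finally show ?thesis .
  qed
  have key: "(\<integral>\<^sup>+x. indicator K x * ennreal (exp t * h (x, t)) \<partial>lebesgue)
      \<le> (\<integral>\<^sup>+s. indicator {0<..<t} s * H s \<partial>lborel)" if t: "0 < t" "t \<le> T" for t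
  proof -
    have "(W \<longlongrightarrow> W 0) (at 0 within {0..})"
      using W_cont unfolding continuous_on_def by auto
    then have "(W \<longlongrightarrow> 0) (at_right 0)"
      unfolding W_0 by (rule tendsto_within_subset) auto
    then have "((\<lambda>c. ennreal (exp c * W c)) \<longlongrightarrow> ennreal (exp 0 * 0)) (at_right 0)"
      by (intro tendsto_intros)
    then have "((\<lambda>c. ennreal (exp c * W c) + (\<integral>\<^sup>+s. indicator {0<..<t} s * H s \<partial>lborel)) \<longlongrightarrow>
        ennreal (exp 0 * 0) + (\<integral>\<^sup>+s. indicator {0<..<t} s * H s \<partial>lborel)) (at_right 0)"
      by (intro tendsto_add tendsto_const)
    moreover have "\<forall>\<^sub>F c in at_right 0. (\<integral>\<^sup>+x. indicator K x * ennreal (exp t * h (x, t)) \<partial>lebesgue)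
      \<le> ennreal (exp c * W c) + (\<integral>\<^sup>+s. indicator {0<..<t} s * H s \<partial>lborel)"
      unfolding eventually_at_right_field using t step by (intro exI[of _ t]) auto
    ultimately have "(\<integral>\<^sup>+x. indicator K x * ennreal (exp t * h (x, t)) \<partial>lebesgue)
        \<le> ennreal (exp 0 * 0) + (\<integral>\<^sup>+s. indicator {0<..<t} s * H s \<partial>lborel)"
      by (rule tendsto_lowerbound) simp
    then show ?thesis by simp
  qed
  have H_eq: "AE t in lborel. t \<in> {0<..T} \<longrightarrow> H t = (\<integral>\<^sup>+x. indicator K x * ennreal (exp t * h (x, t)) \<partial>lebesgue)"
    using hB_slice
  proof eventually_elim
    fix t
    assume *: "t \<in> {0<..T} \<longrightarrow>
      (AE y in lborel. B (y, t) = ennreal (h (y, t)) \<and> B (y, t) = indicator K y * ennreal (h (y, t)))"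
    show "t \<in> {0<..T} \<longrightarrow> H t = (\<integral>\<^sup>+x. indicator K x * ennreal (exp t * h (x, t)) \<partial>lebesgue)"
    proof
      assume "t \<in> {0<..T}"
      with * have "AE y in lborel. B (y, t) = indicator K y * ennreal (h (y, t))" by auto
      then have "AE y in lborel. ennreal (exp t) * B (y, t) = indicator K y * ennreal (exp t * h (y, t))"
        by eventually_elim (simp add: ennreal_mult' mult_ac)
      then show "H t = (\<integral>\<^sup>+x. indicator K x * ennreal (exp t * h (x, t)) \<partial>lebesgue)"
        unfolding H_def nn_integral_completion by (rule nn_integral_cong_AE)
    qed
  qed
  have fin: "(\<integral>\<^sup>+t. indicator {0<..T} t * H t \<partial>lborel) < \<infinity>"
  proof -
    have "compact (W ` {0..T})"
      by (intro compact_continuous_image continuous_on_subset[OF W_cont]) auto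
    then have "bounded (W ` {0..T})" by (rule compact_imp_bounded)
    then obtain M where M: "\<forall>y\<in>W ` {0..T}. norm y \<le> M" unfolding bounded_iff by (elim exE)
    have "(\<integral>\<^sup>+t. indicator {0<..T} t * H t \<partial>lborel) \<le> (\<integral>\<^sup>+t. ennreal (exp T * M) * indicator {0<..T} t \<partial>lborel)"
    proof (rule nn_integral_mono_AE)
      show "AE t in lborel. indicator {0<..T} t * H t \<le> ennreal (exp T * M) * indicator {0<..T} t"
        using H_eq
      proof eventually_elim
        fix t assume *: "t \<in> {0<..T} \<longrightarrow> H t = (\<integral>\<^sup>+x. indicator K x * ennreal (exp t * h (x, t)) \<partial>lebesgue)"
        show "indicator {0<..T} t * H t \<le> ennreal (exp T * M) * indicator {0<..T} t"
        proof (cases "t \<in> {0<..T}")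
          case True
          then have t: "0 < t" "t \<le> T" by auto
          have "H t = (\<integral>\<^sup>+x. indicator K x * ennreal (exp t * h (x, t)) \<partial>lebesgue)" using * True by simp
          also have "\<dots> \<le> (\<integral>\<^sup>+x. ennreal (exp T) * (indicator K x * ennreal \<bar>u x t - v x t\<bar>) \<partial>lebesgue)"
          proof (intro nn_integral_mono)
            fix x
            have "exp t * h (x, t) \<le> exp t * \<bar>u x t - v x t\<bar>"
              using psi_nonneg[of t x] t \<open>0 \<le> \<delta>\<close> by (simp add: h_def)
            also have "\<dots> \<le> exp T * \<bar>u x t - v x t\<bar>"
              using t by (intro mult_right_mono) auto
            finally have "ennreal (exp t * h (x, t)) \<le> ennreal (exp T) * ennreal \<bar>u x t - v x t\<bar>"
              by (simp add: ennreal_mult'[symmetric] ennreal_leI)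
            then show "indicator K x * ennreal (exp t * h (x, t)) \<le> ennreal (exp T) * (indicator K x * ennreal \<bar>u x t - v x t\<bar>)"
              by (auto simp: indicator_def)
          qed
          also have "\<dots> = ennreal (exp T) * ennreal (W t)"
            using t by (simp add: W_nn)
          also have "\<dots> \<le> ennreal (exp T) * ennreal M"
          proof -
            have "\<bar>W t\<bar> \<le> M" using M t by auto
            then show ?thesis by (intro mult_left_mono ennreal_leI) auto
          qed
          finally show ?thesis using True by (simp add: ennreal_mult')
        qed simp
      qed
    qed
    also have "\<dots> < \<infinity>"
      using \<open>0 < d\<close> \<open>d \<le> T\<close> by (simp add: nn_integral_cmult ennreal_mult_less_top)
    finally show ?thesis .
  qed
  have zero: "(\<integral>\<^sup>+t. indicator {0<..T} t * H t \<partial>lborel) = 0"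
  proof (rule nn_integral_gronwall[OF H_meas _ fin])
    show "AE t in lborel. t \<in> {0<..T} \<longrightarrow> H t \<le> (\<integral>\<^sup>+s. indicator {0<..<t} s * H s \<partial>lborel)"
      using H_eq by eventually_elim (use key in auto)
  qed
  have "(\<integral>\<^sup>+x. indicator K x * ennreal (exp d * h (x, d)) \<partial>lebesgue) \<le> (\<integral>\<^sup>+s. indicator {0<..<d} s * H s \<partial>lborel)"
    using \<open>0 < d\<close> \<open>d \<le> T\<close> by (rule key)
  also have "\<dots> \<le> (\<integral>\<^sup>+t. indicator {0<..T} t * H t \<partial>lborel)"
    using \<open>d \<le> T\<close> by (intro nn_integral_mono) (auto simp: indicator_def)
  finally have "(\<integral>\<^sup>+x. indicator K x * ennreal (exp d * h (x, d)) \<partial>lebesgue) = 0"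
    using zero by simp
  then have "AE x in lebesgue. indicator K x * ennreal (exp d * h (x, d)) = 0"
    using h_slice_meas[OF \<open>0 < d\<close>] by (subst (asm) nn_integral_0_iff_AE) auto
  then show ?thesis
    by eventually_elim (auto simp: h_def indicator_def ennreal_eq_0_iff mult_le_0_iff split: if_splits)
qed

text \<open>
  Where \<open>\<epsilon>\<close> has become smaller than \<open>\<delta>\<close> divided by a bound of \<open>C\<close> on \<open>[0, T]\<close>, the growth
  condition reads \<open>\<bar>u\<bar> \<le> \<delta> \<psi>\<close>.
\<close>

lemma ll_loc_unif_off_ball:
  fixes u \<psi> :: "'a::euclidean_space \<Rightarrow> real \<Rightarrow> real"
  assumes ll: "ll_loc_unif (\<lambda>x t. \<bar>u x t\<bar>) \<psi>"
    and psi_nonneg: "\<And>x t. 0 \<le> t \<Longrightarrow> 0 \<le> \<psi> x t" and "0 < \<delta>" "0 \<le> T"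
  obtains R where "AE t in lebesgue. t \<in> {0..T} \<longrightarrow>
    (AE x in lebesgue. R \<le> norm x \<longrightarrow> \<bar>u x t\<bar> \<le> \<delta> * \<psi> x t)"
proof -
  obtain C \<epsilon> where C: "Linf_loc C" and \<epsilon>: "(\<epsilon> \<longlongrightarrow> 0) at_infinity"
    and bd: "AE (x, t) in lebesgue. 0 \<le> t \<longrightarrow> \<bar>\<bar>u x t\<bar>\<bar> \<le> C t * \<epsilon> x * \<bar>\<psi> x t\<bar>"
    using ll unfolding ll_loc_unif_def by blast
  obtain M where M: "AE t in lebesgue. t \<in> {0..T} \<longrightarrow> \<bar>C t\<bar> \<le> M"
    using C \<open>0 \<le> T\<close> unfolding Linf_loc_def by blast
  have "eventually (\<lambda>x. norm (\<epsilon> x) < \<delta> / (\<bar>M\<bar> + 1)) at_infinity"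
    using \<epsilon> \<open>0 < \<delta>\<close> unfolding tendsto_iff dist_norm by simp
  then obtain R where R: "\<And>x. R \<le> norm x \<Longrightarrow> \<bar>\<epsilon> x\<bar> < \<delta> / (\<bar>M\<bar> + 1)"
    unfolding eventually_at_infinity by auto
  have "AE t in lebesgue. t \<in> {0..T} \<longrightarrow>
    (AE x in lebesgue. R \<le> norm x \<longrightarrow> \<bar>u x t\<bar> \<le> \<delta> * \<psi> x t)"
    using M AE_lebesgue_pair(2)[OF bd]
  proof eventually_elim
    fix t
    assume M: "t \<in> {0..T} \<longrightarrow> \<bar>C t\<bar> \<le> M"
      and bd: "AE x in lebesgue. case (x, t) of (x, t) \<Rightarrow> 0 \<le> t \<longrightarrow> \<bar>\<bar>u x t\<bar>\<bar> \<le> C t * \<epsilon> x * \<bar>\<psi> x t\<bar>"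
    show "t \<in> {0..T} \<longrightarrow> (AE x in lebesgue. R \<le> norm x \<longrightarrow> \<bar>u x t\<bar> \<le> \<delta> * \<psi> x t)"
    proof
      assume t: "t \<in> {0..T}"
      show "AE x in lebesgue. R \<le> norm x \<longrightarrow> \<bar>u x t\<bar> \<le> \<delta> * \<psi> x t"
        using bd
      proof (eventually_elim, intro impI)
        fix x
        assume "case (x, t) of (x, t) \<Rightarrow> 0 \<le> t \<longrightarrow> \<bar>\<bar>u x t\<bar>\<bar> \<le> C t * \<epsilon> x * \<bar>\<psi> x t\<bar>" and x: "R \<le> norm x"
        then have "\<bar>u x t\<bar> \<le> C t * \<epsilon> x * \<psi> x t"
          using t psi_nonneg[of t x] by simp
        also have "\<dots> \<le> \<delta> * \<psi> x t"
        proof (rule mult_right_mono)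
          have "C t * \<epsilon> x \<le> \<bar>C t\<bar> * \<bar>\<epsilon> x\<bar>"
            by (metis abs_ge_self abs_mult)
          also have "\<dots> \<le> (\<bar>M\<bar> + 1) * (\<delta> / (\<bar>M\<bar> + 1))"
            using M t R[OF x] \<open>0 < \<delta>\<close> by (intro mult_mono) auto
          also have "\<dots> = \<delta>" by simp
          finally show "C t * \<epsilon> x \<le> \<delta>" .
        qed (use t psi_nonneg in auto)
        finally show "\<bar>u x t\<bar> \<le> \<delta> * \<psi> x t" .
      qed
    qed
  qed
  then show thesis by (rule that)
qed

theorem theorem3p2:
  fixes J :: "'a::euclidean_space \<Rightarrow> real"
    and u0 :: "'a \<Rightarrow> real"
    and \<psi> :: "'a \<Rightarrow> real \<Rightarrow> real"
  assumes J_cont: "continuous_on UNIV J"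
    and J_nonneg: "\<And>x. 0 \<le> J x"
    and J_sym: "\<And>x. J (- x) = J x"
    and J_mass: "has_bochner_integral lebesgue J 1"
    and u0_bdd: "locally_bounded u0"
    and psi_cont: "continuous_on (UNIV \<times> {0..}) (\<lambda>(x, t). \<psi> x t)"
    and psi_nonneg: "\<And>x t. 0 \<le> t \<Longrightarrow> 0 \<le> \<psi> x t"
    and psi_infinity: "\<And>M. \<forall>\<^sub>F x in at_infinity. \<forall>t\<ge>0. M \<le> \<psi> x t"
    and psi_super: "supersolution J \<psi>"
  shows "\<forall>u v. strong_solution J u0 u \<and> ll_loc_unif (\<lambda>x t. \<bar>u x t\<bar>) \<psi> \<and>
               strong_solution J u0 v \<and> ll_loc_unif (\<lambda>x t. \<bar>v x t\<bar>) \<psi> \<longrightarrow>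
               (\<forall>t\<ge>0. AE x in lebesgue. u x t = v x t)"
proof (intro allI impI, elim conjE)
  fix u v :: "'a \<Rightarrow> real \<Rightarrow> real" and t :: real
  assume u: "strong_solution J u0 u" and ll_u: "ll_loc_unif (\<lambda>x t. \<bar>u x t\<bar>) \<psi>"
    and v: "strong_solution J u0 v" and ll_v: "ll_loc_unif (\<lambda>x t. \<bar>v x t\<bar>) \<psi>"
    and "0 \<le> t"
  show "AE x in lebesgue. u x t = v x t"
  proof (cases "t = 0")
    case True
    have "AE x in lebesgue. u x 0 = u0 x" "AE x in lebesgue. v x 0 = u0 x"
      using u v unfolding strong_solution_def by auto
    then show ?thesis
      unfolding True by eventually_elim simp
  next
    case False
    with \<open>0 \<le> t\<close> have "0 < t" by simp
    have "AE x in lebesgue. x \<in> cball 0 (real n) \<longrightarrow> \<bar>u x t - v x t\<bar> \<le> 2 / real (Suc n) * \<psi> x t" for n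
    proof -
      have pos: "0 < 1 / real (Suc n)" by simp
      obtain Ru where Ru: "AE s in lebesgue. s \<in> {0..t} \<longrightarrow>
          (AE x in lebesgue. Ru \<le> norm x \<longrightarrow> \<bar>u x s\<bar> \<le> 1 / real (Suc n) * \<psi> x s)"
        using ll_loc_unif_off_ball[OF ll_u psi_nonneg pos \<open>0 \<le> t\<close>] by blast
      obtain Rv where Rv: "AE s in lebesgue. s \<in> {0..t} \<longrightarrow>
          (AE x in lebesgue. Rv \<le> norm x \<longrightarrow> \<bar>v x s\<bar> \<le> 1 / real (Suc n) * \<psi> x s)"
        using ll_loc_unif_off_ball[OF ll_v psi_nonneg pos \<open>0 \<le> t\<close>] by blast
      define R where "R = max (max Ru Rv) (real n)"
      have R: "Ru \<le> R" "Rv \<le> R" "real n \<le> R" by (auto simp: R_def)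
      have "AE s in lebesgue. s \<in> {0<..t} \<longrightarrow>
          (AE x in lebesgue. x \<notin> cball 0 R \<longrightarrow> \<bar>u x s - v x s\<bar> \<le> 2 / real (Suc n) * \<psi> x s)"
        using Ru Rv
      proof (eventually_elim, intro impI)
        fix s
        assume s: "s \<in> {0<..t}"
          and "s \<in> {0..t} \<longrightarrow> (AE x in lebesgue. Ru \<le> norm x \<longrightarrow> \<bar>u x s\<bar> \<le> 1 / real (Suc n) * \<psi> x s)"
          and "s \<in> {0..t} \<longrightarrow> (AE x in lebesgue. Rv \<le> norm x \<longrightarrow> \<bar>v x s\<bar> \<le> 1 / real (Suc n) * \<psi> x s)"
        then have "AE x in lebesgue. Ru \<le> norm x \<longrightarrow> \<bar>u x s\<bar> \<le> 1 / real (Suc n) * \<psi> x s"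
          "AE x in lebesgue. Rv \<le> norm x \<longrightarrow> \<bar>v x s\<bar> \<le> 1 / real (Suc n) * \<psi> x s" by auto
        then show "AE x in lebesgue. x \<notin> cball 0 R \<longrightarrow> \<bar>u x s - v x s\<bar> \<le> 2 / real (Suc n) * \<psi> x s"
        proof (eventually_elim, intro impI)
          fix x
          assume "x \<notin> cball 0 R" and *: "Ru \<le> norm x \<longrightarrow> \<bar>u x s\<bar> \<le> 1 / real (Suc n) * \<psi> x s"
            "Rv \<le> norm x \<longrightarrow> \<bar>v x s\<bar> \<le> 1 / real (Suc n) * \<psi> x s"
          then have "Ru \<le> norm x" "Rv \<le> norm x" using R by (auto simp: dist_norm)
          with * have "\<bar>u x s\<bar> + \<bar>v x s\<bar> \<le> 1 / real (Suc n) * \<psi> x s + 1 / real (Suc n) * \<psi> x s"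
            by (intro add_mono) auto
          also have "\<dots> = 2 / real (Suc n) * \<psi> x s" by simp
          finally show "\<bar>u x s - v x s\<bar> \<le> 2 / real (Suc n) * \<psi> x s" by linarith
        qed
      qed
      then have "AE x in lebesgue. x \<in> cball 0 R \<longrightarrow> \<bar>u x t - v x t\<bar> \<le> 2 / real (Suc n) * \<psi> x t"
        by (intro comparison_on_compact[OF J_cont J_nonneg J_mass u v psi_cont psi_nonneg psi_super _ compact_cball \<open>0 < t\<close> order_refl])
           auto
      then show ?thesis
        by eventually_elim (use R(3) in auto)
    qed
    then have "AE x in lebesgue. \<forall>n::nat. x \<in> cball 0 (real n) \<longrightarrow> \<bar>u x t - v x t\<bar> \<le> 2 / real (Suc n) * \<psi> x t"
      unfolding AE_all_countable by (rule allI)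
    then show ?thesis
    proof eventually_elim
      fix x :: 'a
      assume *: "\<forall>n::nat. x \<in> cball 0 (real n) \<longrightarrow> \<bar>u x t - v x t\<bar> \<le> 2 / real (Suc n) * \<psi> x t"
      obtain N :: nat where N: "norm x \<le> real N" using real_arch_simple by blast
      have "(\<lambda>n. 2 * inverse (real (Suc n)) * \<psi> x t) \<longlonglongrightarrow> 2 * 0 * \<psi> x t"
        by (intro tendsto_intros LIMSEQ_inverse_real_of_nat)
      moreover have "\<bar>u x t - v x t\<bar> \<le> 2 * inverse (real (Suc n)) * \<psi> x t" if "N \<le> n" for n
        using *[rule_format, of n] N that by (simp add: divide_inverse)
      ultimately have "\<bar>u x t - v x t\<bar> \<le> 2 * 0 * \<psi> x t"
        by (intro LIMSEQ_le_const) auto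
      then show "u x t = v x t" by simp
    qed
  qed
qed

end
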